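(* Let $G$ be a countable discrete amenable group acting (by homeomorphisms) on a compact, metrizable, zero-dimensional space $X$. If the action $G\curvearrowright X$ is essentially free, then it is almost finite in measure.
   Context: $M_G(X)$ denotes the set of $G$-invariant Borel probability measures on $X$. The action is essentially free if for every $g\in G\setminus\{1\}$ and every $\mu\in M_G(X)$ one has $\mu(\{x\in X: g\cdot x=x\})=0$. For a finite set $K\subseteq G$ and $\delta>0$, a nonempty finite set $F\subseteq G$ is $(K,\delta)$-invariant if $|KF\triangle F|/|F|<\delta$, where $KF=\{kf:k\in K,f\in F\}$. For a nonempty finite $F\subseteq G$ and $A\subseteq X$ put $\underline{D}_F(A)=\inf_{x\in X}\frac{|\{t\in F: tx\in A\}|}{|F|}$. The lower Banach density of $A$ is $\underline{D}(A)=\sup_F\underline{D}_F(A)$, with $F$ ranging over nonempty finite subsets of $G$. A tower is a pair $(S,V)$ with $S\subseteq G$ finite and $V\subseteq X$ such that the sets $sV$, $s\in S$ (its levels), are pairwise disjoint; $S$ is its shape and $V$ its base. A castle is a finite collection $\{(S_i,V_i)\}_{i\in I}$ of towers such that all levels of all towers are pairwise disjoint; its footprint is $\bigsqcup_{i\in I}S_iV_i$. A castle is open if all its bases are open. Fix a metric on $X$ compatible with its topology. The action is almost finite in measure if for every finite $K\subseteq G$ and all $\delta,\varepsilon>0$ there is an open castle $\{(S_i,V_i)\}_{i\in I}$ such that (i) each level $sV_i$ ($s\in S_i$, $i\in I$) has diameter at most $\delta$; (ii) each shape $S_i$ is $(K,\delta)$-invariant; (iii) $\underline{D}\big(\bigsqcup_{i\in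 I}S_iV_i\big)\ge 1-\varepsilon$.
   Formalization: In the definition of almost finiteness in measure, K ranges over nonempty finite subsets of G (for K empty and δ ≤ 1 no set is (K,δ)-invariant, so the property would always fail); X is taken to be nonempty, so that the infimum over X makes sense. *)

theory Defs
  imports "HOL-Probability.Probability" "HOL-Algebra.Group_Action" "HOL-Algebra.Coset"
begin

text \<open>
  Groups are in the style of HOL-Algebra; a group \<open>G\<close> acts on the whole of a type \<open>'x\<close>, so
  \<open>g \<cdot> x\<close> is \<open>\<phi> g x\<close>. The library homomorphism \<open>\<phi>\<close> into the bijections of \<open>'x\<close> is only
  constrained on \<open>carrier G\<close>.
\<close>

definition acts_by_homeomorphisms ::
  "('g, 'b) monoid_scheme \<Rightarrow> ('g \<Rightarrow> 'x \<Rightarrow> 'x::topological_space) \<Rightarrow> bool" where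
  "acts_by_homeomorphisms G \<phi> \<longleftrightarrow>
     group_action G UNIV \<phi> \<and> (\<forall>g\<in>carrier G. homeomorphic_map euclidean euclidean (\<phi> g))"

definition invariant_measures ::
  "('g, 'b) monoid_scheme \<Rightarrow> ('g \<Rightarrow> 'x \<Rightarrow> 'x::topological_space) \<Rightarrow> 'x measure set" where
  "invariant_measures G \<phi> =
     {M. sets M = sets borel \<and> prob_space M \<and> (\<forall>g\<in>carrier G. distr M borel (\<phi> g) = M)}"

definition essentially_free ::
  "('g, 'b) monoid_scheme \<Rightarrow> ('g \<Rightarrow> 'x \<Rightarrow> 'x::topological_space) \<Rightarrow> bool" where
  "essentially_free G \<phi> \<longleftrightarrow>
     (\<forall>g\<in>carrier G - {\<one>\<^bsub>G\<^esub>}. \<forall>M\<in>invariant_measures G \<phi>. measure M {x. \<phi> g x = x} = 0)"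

definition approx_invariant ::
  "('g, 'b) monoid_scheme \<Rightarrow> 'g set \<Rightarrow> real \<Rightarrow> 'g set \<Rightarrow> bool" where
  "approx_invariant G K \<delta> F \<longleftrightarrow>
     F \<subseteq> carrier G \<and> finite F \<and> F \<noteq> {} \<and>
     real (card (sym_diff (K <#>\<^bsub>G\<^esub> F) F)) / real (card F) < \<delta>"

text \<open>
  Amenability of a discrete group is the Foelner condition. The set \<open>K\<close> has to be nonempty, here
  and in almost finiteness below: for \<open>K = {}\<close> the quotient above is always \<open>1\<close>, so that no set at
  all would be approximately invariant once \<open>\<delta> \<le> 1\<close>.
\<close>

definition amenable_group :: "('g, 'b) monoid_scheme \<Rightarrow> bool" where
  "amenable_group G \<longleftrightarrow> group G \<and>
     (\<forall>K \<delta>. K \<subseteq> carrier G \<and> finite K \<and> K \<noteq> {} \<and> 0 < \<delta> \<longrightarrow> (\<exists>F. approx_invariant G K \<delta> F))"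

definition lower_density_along :: "('g \<Rightarrow> 'x \<Rightarrow> 'x) \<Rightarrow> 'g set \<Rightarrow> 'x set \<Rightarrow> real" where
  "lower_density_along \<phi> F A = (INF x. real (card {t \<in> F. \<phi> t x \<in> A}) / real (card F))"

definition lower_banach_density ::
  "('g, 'b) monoid_scheme \<Rightarrow> ('g \<Rightarrow> 'x \<Rightarrow> 'x) \<Rightarrow> 'x set \<Rightarrow> real" where
  "lower_banach_density G \<phi> A =
     (SUP F\<in>{F. F \<subseteq> carrier G \<and> finite F \<and> F \<noteq> {}}. lower_density_along \<phi> F A)"

definition tower ::
  "('g, 'b) monoid_scheme \<Rightarrow> ('g \<Rightarrow> 'x \<Rightarrow> 'x) \<Rightarrow> 'g set \<Rightarrow> 'x set \<Rightarrow> bool" where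
  "tower G \<phi> S V \<longleftrightarrow> S \<subseteq> carrier G \<and> finite S \<and> disjoint_family_on (\<lambda>s. \<phi> s ` V) S"

definition castle ::
  "('g, 'b) monoid_scheme \<Rightarrow> ('g \<Rightarrow> 'x \<Rightarrow> 'x) \<Rightarrow> 'i set \<Rightarrow> ('i \<Rightarrow> 'g set) \<Rightarrow> ('i \<Rightarrow> 'x set) \<Rightarrow> bool" where
  "castle G \<phi> I S V \<longleftrightarrow>
     finite I \<and> (\<forall>i\<in>I. tower G \<phi> (S i) (V i)) \<and>
     disjoint_family_on (\<lambda>(i, s). \<phi> s ` V i) (SIGMA i:I. S i)"

definition open_castle ::
  "('g, 'b) monoid_scheme \<Rightarrow> ('g \<Rightarrow> 'x \<Rightarrow> 'x::topological_space) \<Rightarrow>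
     'i set \<Rightarrow> ('i \<Rightarrow> 'g set) \<Rightarrow> ('i \<Rightarrow> 'x set) \<Rightarrow> bool" where
  "open_castle G \<phi> I S V \<longleftrightarrow> castle G \<phi> I S V \<and> (\<forall>i\<in>I. open (V i))"

definition footprint ::
  "('g \<Rightarrow> 'x \<Rightarrow> 'x) \<Rightarrow> 'i set \<Rightarrow> ('i \<Rightarrow> 'g set) \<Rightarrow> ('i \<Rightarrow> 'x set) \<Rightarrow> 'x set" where
  "footprint \<phi> I S V = (\<Union>i\<in>I. \<Union>s\<in>S i. \<phi> s ` V i)"

text \<open>Castles are finite, so indexing them by natural numbers is no restriction.\<close>

definition almost_finite_in_measure ::
  "('g, 'b) monoid_scheme \<Rightarrow> ('g \<Rightarrow> 'x \<Rightarrow> 'x::metric_space) \<Rightarrow> bool" where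
  "almost_finite_in_measure G \<phi> \<longleftrightarrow>
     (\<forall>K \<delta> \<epsilon>. K \<subseteq> carrier G \<and> finite K \<and> K \<noteq> {} \<and> 0 < \<delta> \<and> 0 < \<epsilon> \<longrightarrow>
       (\<exists>(I :: nat set) S V.
          open_castle G \<phi> I S V \<and>
          (\<forall>i\<in>I. \<forall>s\<in>S i. diameter (\<phi> s ` V i) \<le> \<delta>) \<and>
          (\<forall>i\<in>I. approx_invariant G K \<delta> (S i)) \<and>
          lower_banach_density G \<phi> (footprint \<phi> I S V) \<ge> 1 - \<epsilon>))"

end

theory Submission
  imports Defs
begin

text \<open>
  Lower Banach density can be read off from invariant measures. If every invariant measure gives
  the footprint \<open>C\<close> of a clopen castle mass more than \<open>1 - \<epsilon>\<close>, then a single finite set \<open>F\<close> already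
  witnesses density at least \<open>1 - \<epsilon>\<close>: otherwise the frequencies of visits to \<open>- C\<close> along longer
  and longer Foelner sets have, by compactness, an invariant finitely additive limit that gives
  \<open>- C\<close> mass at least \<open>\<epsilon>\<close>, and since \<open>X\<close> is compact and zero-dimensional the restriction of that
  limit to the clopen sets extends to an invariant Borel measure. This is
  \<open>uniformly_small_frequency\<close>. It is stated for decreasing sequences of clopen sets because it is
  needed a second time: essential freeness says that the closed set of points on which some finite
  set \<open>F\<close> does not act freely is null for all invariant measures at once, so some clopen
  neighbourhood of it is small for all of them at once. Away from this neighbourhood finitely many
  clopen sets \<open>U\<close> cover, each of which carries a tower with shape \<open>F\<close> and tiny levels
  (\<open>fine_bases_cover_up_to_small_measure\<close>).

  It remains to build a clopen castle that is large for all invariant measures, and this is the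
  quasi-tiling argument of Ornstein and Weiss. Given a castle with footprint \<open>C\<close>, run through the
  sets \<open>U\<close> above; over the points \<open>x \<in> U\<close> for which at most the proportion \<open>\<epsilon>\<close> of \<open>F x\<close> is already
  covered, add towers whose shape is \<open>F\<close> without the covered positions
  (\<open>add_towers_over_fine_base\<close>). Losing an \<open>\<epsilon>\<close>-fraction does not spoil approximate invariance.
  Afterwards, outside a set of small measure, every \<open>x\<close> has at least the proportion \<open>\<epsilon>\<close> of \<open>F x\<close>
  covered, and if \<open>C\<close> is almost invariant under \<open>F\<close> then, again up to small measure, every \<open>x \<in> C\<close>
  has all of \<open>F x\<close> covered. Averaging over \<open>F\<close>, the
  uncovered mass shrinks by the factor \<open>1 - \<epsilon>\<close> up to a small error (\<open>measure_gain_from_hits\<close>), so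
  after \<open>n\<close> rounds it is about \<open>(1 - \<epsilon>) ^ n\<close>.

  Each round needs its set \<open>F\<close> to be chosen before the castle that it improves, since that castle has
  to be almost invariant under \<open>F\<close>. Hence the induction \<open>fine_castle_of_large_measure\<close> carries along
  an arbitrary finite set \<open>L\<close> under which the footprint is to be almost invariant. This invariance
  is a property of the union of the untrimmed translates of \<open>F\<close>, so it is as good as that of the
  sets \<open>F\<close> and is not limited by the fixed \<open>\<epsilon>\<close> lost in trimming them
  (\<open>boundary_of_added_towers\<close>).
\<close>

section \<open>Exhausting open sets\<close>

text \<open>
  The points whose distance to the complement of \<open>W\<close> is at least \<open>1 / (n + 1)\<close> form compact sets that
  exhaust \<open>W\<close>, and finitely many members of the basis suffice for each of them. This serves both to
  generate the Borel sets from the clopen ones and to exhaust the free part of the space.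
\<close>

lemma open_exhaustion_by_finite_subfamilies:
  fixes W :: "'x::metric_space set"
  assumes "compact (UNIV :: 'x set)" and "open W"
    and basis: "\<And>x. x \<in> W \<Longrightarrow> \<exists>B\<in>\<B>. open B \<and> x \<in> B \<and> B \<subseteq> W"
  obtains \<U> :: "nat \<Rightarrow> 'x set set"
  where "\<And>n. finite (\<U> n)" "\<And>n. \<U> n \<subseteq> \<B>" "mono \<U>" "(\<Union>n. \<Union>(\<U> n)) = W"
proof -
  define Q where "Q n = {x. \<forall>y. y \<notin> W \<longrightarrow> 1 / real (Suc n) \<le> dist x y}" for n
  have "closed (Q n)" for n
    unfolding Q_def by (intro closed_Collect_all closed_Collect_imp closed_Collect_le continuous_intros) auto
  then have cQ: "compact (Q n)" for n
    using assms(1) by (metis compact_Int_closed inf_top.left_neutral)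
  have QW: "Q n \<subseteq> W" for n
    unfolding Q_def by (force simp: not_le)
  have WQ: "\<exists>n. x \<in> Q n" if "x \<in> W" for x
  proof -
    obtain e where e: "e > 0" "ball x e \<subseteq> W"
      using \<open>open W\<close> \<open>x \<in> W\<close> open_contains_ball by blast
    obtain n where "1 / real (Suc n) < e"
      using e(1) nat_approx_posE by blast
    then have "x \<in> Q n"
      unfolding Q_def using e(2) by (smt (verit) mem_Collect_eq mem_ball subsetD)
    then show ?thesis ..
  qed
  define \<C> where "\<C> = {B\<in>\<B>. open B \<and> B \<subseteq> W}"
  have "\<exists>\<V>\<subseteq>\<C>. finite \<V> \<and> Q n \<subseteq> \<Union>\<V>" for n
  proof -
    have "Q n \<subseteq> \<Union>\<C>" using QW[of n] basis unfolding \<C>_def by blast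
    then obtain \<V> where "\<V> \<subseteq> \<C>" "finite \<V>" "Q n \<subseteq> \<Union>\<V>"
      using compactE[OF cQ[of n]] unfolding \<C>_def by (metis (no_types, lifting) mem_Collect_eq)
    then show ?thesis by blast
  qed
  then obtain \<V> where \<V>: "\<And>n. \<V> n \<subseteq> \<C>" "\<And>n. finite (\<V> n)" "\<And>n. Q n \<subseteq> \<Union>(\<V> n)"
    by metis
  show ?thesis
  proof
    show "finite (\<Union>i\<le>n. \<V> i)" for n using \<V>(2) by auto
    show "(\<Union>i\<le>n. \<V> i) \<subseteq> \<B>" for n using \<V>(1) unfolding \<C>_def by blast
    show "mono (\<lambda>n. \<Union>i\<le>n. \<V> i)" by (rule monoI) (force intro: order_trans)
    show "(\<Union>n. \<Union>(\<Union>i\<le>n. \<V> i)) = W"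
    proof
      show "(\<Union>n. \<Union>(\<Union>i\<le>n. \<V> i)) \<subseteq> W" using \<V>(1) unfolding \<C>_def by blast
      show "W \<subseteq> (\<Union>n. \<Union>(\<Union>i\<le>n. \<V> i))"
      proof
        fix x assume "x \<in> W"
        then obtain n where "x \<in> Q n" using WQ by blast
        then show "x \<in> (\<Union>n. \<Union>(\<Union>i\<le>n. \<V> i))" using \<V>(3)[of n] by blast
      qed
    qed
  qed
qed

section \<open>Approximately invariant sets\<close>

lemma (in group) card_translate:
  assumes "k \<in> carrier G" and "F \<subseteq> carrier G"
  shows "card ((\<lambda>t. k \<otimes> t) ` F) = card F"
  using assms by (intro card_image inj_onI) (metis Units_eq Units_l_cancel subsetD)

lemma (in group) card_diff_translate:
  assumes "k \<in> carrier G" and "F \<subseteq> carrier G" and "finite F"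
  shows "card (F - (\<lambda>t. k \<otimes> t) ` F) = card ((\<lambda>t. k \<otimes> t) ` F - F)"
proof -
  let ?kF = "(\<lambda>t. k \<otimes> t) ` F"
  have "card (F - ?kF) + card (F \<inter> ?kF) = card (?kF - F) + card (F \<inter> ?kF)"
    using card_translate[OF assms(1,2)] \<open>finite F\<close>
    by (metis Int_commute add.commute card_Int_Diff finite_imageI)
  then show ?thesis by simp
qed

lemma (in group) approx_invariant_translate:
  assumes "approx_invariant G K \<delta> F" and "k \<in> K" and "K \<subseteq> carrier G" and "finite K"
  shows "real (card ((\<lambda>t. k \<otimes> t) ` F - F)) \<le> \<delta> * real (card F)"
proof -
  have F: "F \<subseteq> carrier G" "finite F" "F \<noteq> {}"
    "real (card (sym_diff (K <#> F) F)) / real (card F) < \<delta>"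
    using assms(1) unfolding approx_invariant_def by auto
  have "finite (K <#> F)"
    unfolding set_mult_def using F(2) \<open>finite K\<close> by auto
  then have "card ((\<lambda>t. k \<otimes> t) ` F - F) \<le> card (sym_diff (K <#> F) F)"
    using F(2) \<open>k \<in> K\<close> by (intro card_mono) (auto simp: set_mult_def)
  moreover have "real (card F) > 0" using F by (simp add: card_gt_0_iff)
  ultimately show ?thesis
    using F(4) by (simp add: pos_divide_less_eq)
qed

text \<open>
  It is convenient to measure invariance by one translate \<open>k F - F\<close> at a time: the part of \<open>K F\<close>
  outside \<open>F\<close> is the union of these, and the part of \<open>F\<close> outside \<open>K F\<close> is contained in
  \<open>F - k F\<close> for any single \<open>k \<in> K\<close>, which has as many elements as \<open>k F - F\<close>.
\<close>

lemma (in group) approx_invariantI: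
  assumes K: "K \<subseteq> carrier G" "finite K" "K \<noteq> {}"
    and F: "F \<subseteq> carrier G" "finite F" "F \<noteq> {}"
    and inv: "\<And>k. k \<in> K \<Longrightarrow> real (card ((\<lambda>t. k \<otimes> t) ` F - F)) \<le> \<eta> * real (card F)"
    and \<eta>: "(real (card K) + 1) * \<eta> < \<delta>"
  shows "approx_invariant G K \<delta> F"
proof -
  obtain k0 where k0: "k0 \<in> K" using K(3) by blast
  let ?tr = "\<lambda>k. (\<lambda>t. k \<otimes> t) ` F"
  have "(K <#> F) - F = (\<Union>k\<in>K. ?tr k - F)" by (auto simp: set_mult_def)
  then have "real (card ((K <#> F) - F)) \<le> (\<Sum>k\<in>K. real (card (?tr k - F)))"
    using card_UN_le[OF K(2), of "\<lambda>k. ?tr k - F"] by (metis of_nat_mono of_nat_sum)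
  also have "\<dots> \<le> real (card K) * (\<eta> * real (card F))"
    using sum_mono[OF inv] by simp
  finally have 1: "real (card ((K <#> F) - F)) \<le> real (card K) * (\<eta> * real (card F))" .
  have "card (F - (K <#> F)) \<le> card (F - ?tr k0)"
    using F(2) k0 by (intro card_mono) (auto simp: set_mult_def)
  also have "\<dots> = card (?tr k0 - F)"
    using card_diff_translate F K(1) k0 by blast
  finally have 2: "real (card (F - (K <#> F))) \<le> \<eta> * real (card F)"
    using inv[OF k0] by linarith
  have "card (sym_diff (K <#> F) F) \<le> card ((K <#> F) - F) + card (F - (K <#> F))"
    by (rule card_Un_le)
  then have "real (card (sym_diff (K <#> F) F)) \<le> (real (card K) + 1) * \<eta> * real (card F)"
    using 1 2 by (simp add: algebra_simps)
  moreover have "real (card F) > 0" using F by (simp add: card_gt_0_iff)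
  ultimately have "real (card (sym_diff (K <#> F) F)) / real (card F) \<le> (real (card K) + 1) * \<eta>"
    by (simp add: pos_divide_le_eq)
  then show ?thesis
    unfolding approx_invariant_def using F \<eta> by linarith
qed

text \<open>
  The bound on \<open>\<epsilon>\<close> involves \<open>K\<close> but not the invariance that \<open>F\<close> has under further elements. This is
  what allows the tiling below to use the same \<open>\<epsilon>\<close> in all rounds, although the sets \<open>F\<close> have to be
  more and more invariant.
\<close>

lemma (in group) approx_invariant_remove_few:
  assumes K: "K \<subseteq> carrier G" "finite K" "K \<noteq> {}"
    and F: "F \<subseteq> carrier G" "finite F" "F \<noteq> {}"
    and inv: "\<And>k. k \<in> K \<Longrightarrow> real (card ((\<lambda>t. k \<otimes> t) ` F - F)) \<le> \<epsilon> * real (card F)"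
    and A: "A \<subseteq> F" "real (card A) \<le> \<epsilon> * real (card F)"
    and \<epsilon>: "0 \<le> \<epsilon>" "\<epsilon> \<le> 1/2" "4 * (real (card K) + 1) * \<epsilon> < \<delta>"
  shows "approx_invariant G K \<delta> (F - A)"
proof (rule approx_invariantI[OF K])
  have finA: "finite A" using A F finite_subset by blast
  have cF: "real (card F) > 0" using F by (simp add: card_gt_0_iff)
  have cS: "real (card (F - A)) = real (card F) - real (card A)"
    using card_Diff_subset[OF finA A(1)] card_mono[OF F(2) A(1)] by simp
  have half: "\<epsilon> * real (card F) \<le> real (card F) / 2"
    using mult_right_mono[OF \<epsilon>(2), of "real (card F)"] by simp
  have S2: "real (card F) \<le> 2 * real (card (F - A))"
    using cS A(2) half by linarith
  show "F - A \<noteq> {}" using S2 cF by (metis card.empty mult_zero_right not_le of_nat_0)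
  show "F - A \<subseteq> carrier G" "finite (F - A)" using F by auto
  show "real (card ((\<lambda>t. k \<otimes> t) ` (F - A) - (F - A))) \<le> 4 * \<epsilon> * real (card (F - A))" if "k \<in> K" for k
  proof -
    have "card ((\<lambda>t. k \<otimes> t) ` (F - A) - (F - A)) \<le> card (((\<lambda>t. k \<otimes> t) ` F - F) \<union> A)"
      using F(2) finA by (intro card_mono) auto
    also have "\<dots> \<le> card ((\<lambda>t. k \<otimes> t) ` F - F) + card A" by (rule card_Un_le)
    finally have "real (card ((\<lambda>t. k \<otimes> t) ` (F - A) - (F - A))) \<le> 2 * (\<epsilon> * real (card F))"
      using inv[OF that] A(2) by linarith
    also have "\<dots> \<le> 2 * (\<epsilon> * (2 * real (card (F - A))))"
      using mult_left_mono[OF S2 \<epsilon>(1)] by linarith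
    finally show ?thesis by (simp add: mult_ac)
  qed
  show "(real (card K) + 1) * (4 * \<epsilon>) < \<delta>" using \<epsilon>(3) by (simp add: mult_ac)
qed

section \<open>Invariant measures as limits of empirical means\<close>

text \<open>
  All averaging arguments below are double counts of this form: a bound on how many of the sets
  \<open>B t\<close> contain each point becomes a bound on the sum of their measures.
\<close>

lemma (in finite_measure) sum_measure_eq_integral_card:
  assumes "finite F" and "\<And>t. t \<in> F \<Longrightarrow> B t \<in> sets M"
  shows "integrable M (\<lambda>x. real (card {t\<in>F. x \<in> B t}))"
    and "(\<Sum>t\<in>F. measure M (B t)) = (LINT x|M. real (card {t\<in>F. x \<in> B t}))"
proof -
  have card_eq: "real (card {t\<in>F. x \<in> B t}) = (\<Sum>t\<in>F. indicator (B t) x)" for x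
    using \<open>finite F\<close> by (simp add: indicator_def sum.If_cases Int_def)
  have int: "integrable M (indicator (B t) :: _ \<Rightarrow> real)" if "t \<in> F" for t
    using assms(2)[OF that] emeasure_finite by (simp add: less_top[symmetric])
  then show "integrable M (\<lambda>x. real (card {t\<in>F. x \<in> B t}))"
    unfolding card_eq by (intro Bochner_Integration.integrable_sum) auto
  have "(LINT x|M. (\<Sum>t\<in>F. indicator (B t) x :: real)) = (\<Sum>t\<in>F. LINT x|M. indicator (B t) x)"
    using int by (intro Bochner_Integration.integral_sum) auto
  also have "\<dots> = (\<Sum>t\<in>F. measure M (B t))"
    using assms(2) by (intro sum.cong refl) (simp add: sets.Int_space_eq2)
  finally show "(\<Sum>t\<in>F. measure M (B t)) = (LINT x|M. real (card {t\<in>F. x \<in> B t}))"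
    unfolding card_eq ..
qed

locale compact_zero_dim_action = group G
  for G :: "('g, 'b) monoid_scheme" (structure) +
  fixes \<phi> :: "'g \<Rightarrow> 'x \<Rightarrow> 'x::metric_space"
  assumes act_mult: "g \<in> carrier G \<Longrightarrow> h \<in> carrier G \<Longrightarrow> \<phi> (g \<otimes> h) x = \<phi> g (\<phi> h x)"
    and act_one [simp]: "\<phi> \<one> x = x"
    and act_continuous: "g \<in> carrier G \<Longrightarrow> continuous_on UNIV (\<phi> g)"
    and compact_UNIV: "compact (UNIV :: 'x set)"
    and clopen_basis: "open (W :: 'x set) \<Longrightarrow> x \<in> W \<Longrightarrow> \<exists>B. open B \<and> closed B \<and> x \<in> B \<and> B \<subseteq> W"
begin

lemma act_inv [simp]:
  assumes "g \<in> carrier G"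
  shows "\<phi> (inv g) (\<phi> g x) = x" and "\<phi> g (\<phi> (inv g) x) = x"
  using assms act_mult[of "inv g" g x] act_mult[of g "inv g" x] by auto

lemma act_eq_iff [simp]: "g \<in> carrier G \<Longrightarrow> \<phi> g x = \<phi> g y \<longleftrightarrow> x = y"
  by (metis act_inv(1))

lemma image_eq_vimage_inv: "g \<in> carrier G \<Longrightarrow> \<phi> g ` A = \<phi> (inv g) -` A"
  by (auto simp: image_iff) (metis act_inv(2))

lemma open_vimage_act: "g \<in> carrier G \<Longrightarrow> open A \<Longrightarrow> open (\<phi> g -` A)"
  using act_continuous open_vimage by blast

lemma closed_vimage_act: "g \<in> carrier G \<Longrightarrow> closed A \<Longrightarrow> closed (\<phi> g -` A)"
  using act_continuous closed_vimage by blast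

lemma act_borel_measurable [measurable]: "g \<in> carrier G \<Longrightarrow> \<phi> g \<in> borel_measurable borel"
  by (intro borel_measurable_continuous_onI act_continuous)

lemma invariant_prob_space:
  assumes "M \<in> invariant_measures G \<phi>"
  shows "prob_space M" and "sets M = sets borel" and "space M = UNIV"
  using assms sets_eq_imp_space_eq[of M borel] unfolding invariant_measures_def by auto

lemma invariant_measure_vimage:
  assumes M: "M \<in> invariant_measures G \<phi>" and g: "g \<in> carrier G" and A: "A \<in> sets borel"
  shows "measure M (\<phi> g -` A) = measure M A"
proof -
  have d: "distr M borel (\<phi> g) = M" using M g unfolding invariant_measures_def by auto
  have "measure M (\<phi> g -` A) = measure (distr M borel (\<phi> g)) A"
    using A act_borel_measurable[OF g] invariant_prob_space[OF M] measurable_cong_sets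
    by (subst measure_distr) auto
  then show ?thesis using d by simp
qed

lemma invariant_measure_image:
  assumes M: "M \<in> invariant_measures G \<phi>" and g: "g \<in> carrier G" and A: "A \<in> sets borel"
  shows "measure M (\<phi> g ` A) = measure M A"
  using invariant_measure_vimage[OF M inv_closed[OF g] A] image_eq_vimage_inv[OF g] by simp

lemma sigma_sets_clopen: "sigma_sets UNIV {A :: 'x set. open A \<and> closed A} = sets borel"
proof -
  have "{A :: 'x set. open A} \<subseteq> sigma_sets UNIV {A. open A \<and> closed A}"
  proof
    fix W :: "'x set" assume "W \<in> {A. open A}"
    then have W: "open W" by simp
    have basis: "\<exists>B\<in>{B. open B \<and> closed B}. open B \<and> x \<in> B \<and> B \<subseteq> W" if "x \<in> W" for x
      using clopen_basis[OF W that] by blast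
    obtain \<U> where \<U>: "\<And>n::nat. finite (\<U> n)" "\<And>n. \<U> n \<subseteq> {B. open B \<and> closed B}"
      "mono \<U>" "(\<Union>n. \<Union>(\<U> n)) = W"
      by (rule open_exhaustion_by_finite_subfamilies[OF compact_UNIV W basis]) auto
    have "\<Union>(\<U> n) \<in> {A. open A \<and> closed A}" for n
      using \<U>(1,2)[of n] by (auto intro!: closed_Union)
    then show "W \<in> sigma_sets UNIV {A. open A \<and> closed A}"
      unfolding \<U>(4)[symmetric] by (intro sigma_sets.Union sigma_sets.Basic)
  qed
  then have "sigma_sets UNIV {A :: 'x set. open A} \<subseteq> sigma_sets UNIV {A. open A \<and> closed A}"
    by (rule sigma_sets_mono)
  moreover have "sigma_sets UNIV {A :: 'x set. open A \<and> closed A} \<subseteq> sigma_sets UNIV {A. open A}"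
    by (rule sigma_sets_mono') auto
  ultimately show ?thesis by (simp add: borel_def)
qed

text \<open>
  Countable additivity on the algebra of clopen sets is automatic, because a decreasing sequence of
  compact sets with empty intersection is eventually empty.
\<close>

lemma clopen_premeasure_extends:
  fixes m :: "'x set \<Rightarrow> real"
  assumes nonneg: "\<And>A. 0 \<le> m A"
    and add: "\<And>A B. A \<inter> B = {} \<Longrightarrow> m (A \<union> B) = m A + m B"
    and one: "m UNIV = 1"
  obtains M where "prob_space M" "sets M = sets borel"
    "\<And>A. open A \<Longrightarrow> closed A \<Longrightarrow> emeasure M A = ennreal (m A)"
proof -
  let ?\<C> = "{A :: 'x set. open A \<and> closed A}"
  interpret algebra UNIV ?\<C>
    by (auto simp: algebra_iff_Un)
  have m0: "m {} = 0" using add[of "{}" "{}"] by simp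
  have "\<exists>\<mu> :: 'x set \<Rightarrow> ennreal. (\<forall>s \<in> ?\<C>. \<mu> s = ennreal (m s)) \<and> measure_space UNIV (sigma_sets UNIV ?\<C>) \<mu>"
  proof (rule caratheodory_empty_continuous)
    show "positive ?\<C> (\<lambda>A. ennreal (m A))" by (simp add: positive_def m0)
    show "additive ?\<C> (\<lambda>A. ennreal (m A))"
      unfolding additive_def using add nonneg by (simp add: ennreal_plus)
    fix A :: "nat \<Rightarrow> 'x set"
    assume A: "range A \<subseteq> ?\<C>" "decseq A" "(\<Inter>i. A i) = {}"
    have "\<exists>n. A n = {}"
    proof (rule ccontr)
      assume ne: "\<not> (\<exists>n. A n = {})"
      have "UNIV \<inter> (\<Inter>i\<in>UNIV. A i) \<noteq> {}"
      proof (rule compact_imp_fip_image[OF compact_UNIV])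
        show "closed (A i)" for i using A(1) by auto
        fix I' :: "nat set" assume "finite I'"
        then have "A (Max (insert 0 I')) \<subseteq> (\<Inter>i\<in>I'. A i)"
          using decseqD[OF A(2)] by (meson INT_greatest Max_ge finite.insertI insertI2)
        then show "UNIV \<inter> (\<Inter>i\<in>I'. A i) \<noteq> {}" using ne by blast
      qed
      then show False using A(3) by simp
    qed
    then obtain n where "A n = {}" by blast
    then have "A k = {}" if "k \<ge> n" for k
      using A(2) that by (metis decseqD subset_empty)
    then have "\<forall>\<^sub>F k in sequentially. ennreal (m (A k)) = 0"
      unfolding eventually_sequentially using m0 by (intro exI[of _ n]) auto
    then show "(\<lambda>i. ennreal (m (A i))) \<longlonglongrightarrow> 0" by (rule tendsto_eventually)
  qed auto
  then obtain \<mu> where \<mu>: "\<And>s. open s \<Longrightarrow> closed s \<Longrightarrow> \<mu> s = ennreal (m s)"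
    "measure_space UNIV (sets (borel :: 'x measure)) \<mu>"
    unfolding sigma_sets_clopen by auto
  define M where "M = measure_of UNIV (sets (borel :: 'x measure)) \<mu>"
  have sb: "sigma_algebra UNIV (sets (borel :: 'x measure))"
    using sets.sigma_algebra_axioms[of borel] by simp
  have sM: "sets M = sets borel"
    unfolding M_def by (simp add: sigma_algebra.sets_measure_of_eq[OF sb])
  have em: "emeasure M A = \<mu> A" if "A \<in> sets borel" for A
    using \<mu>(2) that unfolding M_def measure_space_def
    by (intro emeasure_measure_of_sigma) auto
  have clop: "emeasure M A = ennreal (m A)" if "open A" "closed A" for A
    using em[of A] \<mu>(1)[of A] that by simp
  have "space M = UNIV" using sets_eq_imp_space_eq[OF sM] by simp
  then have "prob_space M"
    using clop[of UNIV] one by (intro prob_spaceI) simp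
  then show ?thesis using that sM clop by blast
qed

text \<open>
  The visits of \<open>x\<close> to \<open>\<phi> k -` A\<close> at times in \<open>F\<close> are its visits to \<open>A\<close> at times in \<open>k F\<close>, so
  that empirical means along a Foelner set are almost invariant.
\<close>

lemma card_translate_diff:
  assumes k: "k \<in> carrier G" and F: "F \<subseteq> carrier G" "finite F"
  shows "\<bar>real (card {t\<in>F. \<phi> t x \<in> \<phi> k -` A}) - real (card {t\<in>F. \<phi> t x \<in> A})\<bar>
    \<le> real (card ((\<lambda>t. k \<otimes> t) ` F - F))"
proof -
  let ?kF = "(\<lambda>t. k \<otimes> t) ` F"
  let ?r = "\<lambda>E. {t\<in>E. \<phi> t x \<in> A}"
  have inj: "inj_on (\<lambda>t. k \<otimes> t) E" if "E \<subseteq> F" for E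
    using k F that by (intro inj_onI) (metis Units_eq Units_l_cancel subsetD)
  have "?r ?kF = (\<lambda>t. k \<otimes> t) ` {t\<in>F. \<phi> t x \<in> \<phi> k -` A}"
    using k F by (auto simp: act_mult subset_iff)
  then have eq: "card (?r ?kF) = card {t\<in>F. \<phi> t x \<in> \<phi> k -` A}"
    by (simp add: card_image inj)
  have fin: "finite ?kF" "finite F" using F by auto
  have "card (?r ?kF) \<le> card (?r F \<union> (?kF - F))" using fin by (intro card_mono) auto
  also have "\<dots> \<le> card (?r F) + card (?kF - F)" by (rule card_Un_le)
  finally have 1: "card (?r ?kF) \<le> card (?r F) + card (?kF - F)" .
  have "card (?r F) \<le> card (?r ?kF \<union> (F - ?kF))" using fin by (intro card_mono) auto
  also have "\<dots> \<le> card (?r ?kF) + card (F - ?kF)" by (rule card_Un_le)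
  finally have 2: "card (?r F) \<le> card (?r ?kF) + card (?kF - F)"
    using card_diff_translate[OF k F] by simp
  show ?thesis using 1 2 eq by linarith
qed

lemma compact_unit_valued: "compact {m :: 'a set \<Rightarrow> real. \<forall>A. m A \<in> {0..1}}"
proof -
  have "compactin (product_topology (\<lambda>_. euclidean) UNIV) (PiE UNIV (\<lambda>_ :: 'a set. {0..1::real}))"
    by (simp add: compactin_PiE)
  then show ?thesis
    by (simp add: euclidean_product_topology PiE_UNIV_domain Pi_def)
qed

lemma closed_set_function_conditions:
  fixes c :: real
  shows "closed {m :: 'a set \<Rightarrow> real. m A \<ge> c}"
    and "closed {m :: 'a set \<Rightarrow> real. \<bar>m A - m B\<bar> \<le> c}"
    and "closed {m :: 'a set \<Rightarrow> real. m A = c}"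
    and "closed {m :: 'a set \<Rightarrow> real. m A = m B + m C}"
  by (intro closed_Collect_le closed_Collect_eq continuous_intros continuous_on_product_coordinates)+

text \<open>
  The empirical means \<open>A \<mapsto> card {t\<in>F. \<phi> t x \<in> A} / card F\<close> live in the compact space of functions
  from sets to the unit interval. Almost invariance and mass at least \<open>c\<close> on \<open>N n\<close> are closed
  conditions, and any finitely many of them are met by one empirical mean, so all can be met at
  once.
\<close>

lemma invariant_mean_exists:
  fixes N :: "nat \<Rightarrow> 'x set"
  assumes amenable: "amenable_group G" and "decseq N"
    and large: "\<And>n F. F \<subseteq> carrier G \<Longrightarrow> finite F \<Longrightarrow> F \<noteq> {} \<Longrightarrow>
      \<exists>x. c * real (card F) \<le> real (card {t\<in>F. \<phi> t x \<in> N n})"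
  obtains m :: "'x set \<Rightarrow> real"
  where "\<And>A. 0 \<le> m A" "\<And>A B. A \<inter> B = {} \<Longrightarrow> m (A \<union> B) = m A + m B" "m UNIV = 1"
    "\<And>g A. g \<in> carrier G \<Longrightarrow> m (\<phi> g -` A) = m A" "\<And>n. c \<le> m (N n)"
proof -
  define P where "P = {m :: 'x set \<Rightarrow> real. (\<forall>A. m A \<in> {0..1}) \<and> m UNIV = 1 \<and>
    (\<forall>A B. A \<inter> B = {} \<longrightarrow> m (A \<union> B) = m A + m B)}"
  have "closed {m :: 'x set \<Rightarrow> real. m UNIV = 1 \<and>
    (\<forall>A B. A \<inter> B = {} \<longrightarrow> m (A \<union> B) = m A + m B)}"
    by (intro closed_Collect_conj closed_Collect_all closed_Collect_imp closed_set_function_conditions) auto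
  from compact_Int_closed[OF compact_unit_valued this] have "compact P"
    unfolding P_def by (simp add: Int_def conj_ac)
  define Z where "Z = (\<lambda>(k, j, n). {m. (\<forall>A. \<bar>m (\<phi> k -` A) - m A\<bar> \<le> 1 / real (Suc j)) \<and> c \<le> m (N n)})"
  define J where "J = carrier G \<times> (UNIV :: nat set) \<times> (UNIV :: nat set)"
  have "P \<inter> (\<Inter>(Z ` J)) \<noteq> {}"
  proof (rule compact_imp_fip_image[OF \<open>compact P\<close>])
    fix i
    show "closed (Z i)"
      unfolding Z_def by (cases i; simp; intro closed_Collect_conj closed_Collect_all closed_set_function_conditions)
  next
    fix J' assume J': "finite J'" "J' \<subseteq> J"
    \<comment> \<open>\<open>\<one>\<close> and \<open>0\<close> are inserted only to have nonempty sets when \<open>J'\<close> is empty.\<close>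
    define K where "K = insert \<one> (fst ` J')"
    define j0 where "j0 = Max (insert 0 ((fst \<circ> snd) ` J'))"
    define n0 where "n0 = Max (insert 0 ((snd \<circ> snd) ` J'))"
    have K: "finite K" "K \<subseteq> carrier G" "K \<noteq> {}" using J' unfolding K_def J_def by auto
    then obtain F where F: "approx_invariant G K (1 / real (Suc j0)) F"
      using amenable unfolding amenable_group_def by (metis of_nat_0_less_iff zero_less_Suc zero_less_divide_1_iff)
    then have F': "F \<subseteq> carrier G" "finite F" "F \<noteq> {}" unfolding approx_invariant_def by auto
    then have cF: "real (card F) > 0" by (simp add: card_gt_0_iff)
    obtain x where x: "c * real (card F) \<le> real (card {t\<in>F. \<phi> t x \<in> N n0})"
      using large F' by blast
    define m where "m A = real (card {t\<in>F. \<phi> t x \<in> A}) / real (card F)" for A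
    have "m \<in> P"
    proof -
      have "card {t\<in>F. \<phi> t x \<in> A} \<le> card F" for A
        using F'(2) by (intro card_mono) auto
      moreover have "card {t\<in>F. \<phi> t x \<in> A \<union> B} = card {t\<in>F. \<phi> t x \<in> A} + card {t\<in>F. \<phi> t x \<in> B}"
        if "A \<inter> B = {}" for A B
      proof -
        have "{t\<in>F. \<phi> t x \<in> A \<union> B} = {t\<in>F. \<phi> t x \<in> A} \<union> {t\<in>F. \<phi> t x \<in> B}" by auto
        then show ?thesis using F'(2) that by (simp add: card_Un_disjoint disjoint_iff)
      qed
      ultimately show ?thesis
        using cF unfolding P_def m_def by (auto simp: divide_simps)
    qed
    moreover have "m \<in> Z i" if i: "i \<in> J'" for i
    proof -
      obtain k j n where ijk: "i = (k, j, n)" by (cases i)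
      have k: "k \<in> K" using i ijk unfolding K_def by force
      have j: "j \<le> j0" unfolding j0_def using i ijk J' by (intro Max_ge) force+
      have n: "n \<le> n0" unfolding n0_def using i ijk J' by (intro Max_ge) force+
      have "\<bar>m (\<phi> k -` A) - m A\<bar> \<le> 1 / real (Suc j)" for A
      proof -
        have "\<bar>m (\<phi> k -` A) - m A\<bar> \<le> real (card ((\<lambda>t. k \<otimes> t) ` F - F)) / real (card F)"
          using card_translate_diff[of k F x A] k K F' cF unfolding m_def
          by (auto simp flip: diff_divide_distrib abs_divide simp: abs_divide divide_right_mono)
        also have "\<dots> \<le> 1 / real (Suc j0)"
          using approx_invariant_translate[OF F k K(2,1)] cF by (simp add: pos_divide_le_eq)
        also have "\<dots> \<le> 1 / real (Suc j)" using j by (simp add: frac_le)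
        finally show ?thesis .
      qed
      moreover have "c \<le> m (N n)"
      proof -
        have "card {t\<in>F. \<phi> t x \<in> N n0} \<le> card {t\<in>F. \<phi> t x \<in> N n}"
          using decseqD[OF \<open>decseq N\<close> n] F' by (intro card_mono) auto
        then have "c * real (card F) \<le> real (card {t\<in>F. \<phi> t x \<in> N n})"
          using x by linarith
        then show ?thesis unfolding m_def using cF by (simp add: pos_le_divide_eq)
      qed
      ultimately show ?thesis unfolding Z_def ijk by simp
    qed
    ultimately show "P \<inter> (\<Inter>(Z ` J')) \<noteq> {}" by blast
  qed
  then obtain m where m: "m \<in> P" "\<And>i. i \<in> J \<Longrightarrow> m \<in> Z i" by blast
  show ?thesis
  proof
    show "m (\<phi> g -` A) = m A" if "g \<in> carrier G" for g A
    proof -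
      have "\<bar>m (\<phi> g -` A) - m A\<bar> \<le> 1 / real (Suc j)" for j
        using m(2)[of "(g, j, 0)"] that unfolding Z_def J_def by auto
      then have "\<not> 0 < \<bar>m (\<phi> g -` A) - m A\<bar>"
        using nat_approx_posE not_le by metis
      then show ?thesis by simp
    qed
    show "c \<le> m (N n)" for n
      using m(2)[of "(\<one>, 0, n)"] unfolding Z_def J_def by auto
  qed (use m(1) in \<open>auto simp: P_def\<close>)
qed

text \<open>
  The bridge between invariant measures and frequencies of visits. If no finite set \<open>F\<close> worked for
  any \<open>n\<close>, an invariant mean would give every \<open>N n\<close> mass at least \<open>c\<close>; the invariant measure that
  extends it from the clopen sets then gives the intersection mass at least \<open>c\<close>, by continuity from
  above.
\<close>

proposition uniformly_small_frequency:
  fixes N :: "nat \<Rightarrow> 'x set"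
  assumes "amenable_group G" and "decseq N" and N: "\<And>n. open (N n)" "\<And>n. closed (N n)"
    and small: "\<And>M. M \<in> invariant_measures G \<phi> \<Longrightarrow> measure M (\<Inter>n. N n) < c"
  obtains n F where "F \<subseteq> carrier G" "finite F" "F \<noteq> {}"
    "\<And>x. real (card {t\<in>F. \<phi> t x \<in> N n}) < c * real (card F)"
proof (rule ccontr)
  assume neg: "\<not> thesis"
  have large: "\<exists>x. c * real (card F) \<le> real (card {t\<in>F. \<phi> t x \<in> N n})"
    if "F \<subseteq> carrier G" "finite F" "F \<noteq> {}" for n F
    using that \<open>\<And>n F. \<lbrakk>F \<subseteq> carrier G; finite F; F \<noteq> {};
      \<And>x. real (card {t\<in>F. \<phi> t x \<in> N n}) < c * real (card F)\<rbrakk> \<Longrightarrow> thesis\<close> neg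
    by (meson not_le)
  obtain m :: "'x set \<Rightarrow> real" where m: "\<And>A. 0 \<le> m A" "\<And>A B. A \<inter> B = {} \<Longrightarrow> m (A \<union> B) = m A + m B" "m UNIV = 1"
    "\<And>g A. g \<in> carrier G \<Longrightarrow> m (\<phi> g -` A) = m A" "\<And>n. c \<le> m (N n)"
    by (rule invariant_mean_exists[OF assms(1,2), of c]) (use large in blast)+
  obtain M where M: "prob_space M" "sets M = sets borel"
    "\<And>A. open A \<Longrightarrow> closed A \<Longrightarrow> emeasure M A = ennreal (m A)"
    by (rule clopen_premeasure_extends[of m]) (use m(1-3) in auto)
  interpret prob_space M by fact
  have spM: "space M = UNIV" using sets_eq_imp_space_eq[OF M(2)] by simp
  have "distr M borel (\<phi> g) = M" if g: "g \<in> carrier G" for g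
  proof (rule measure_eqI_generator_eq[where \<Omega> = UNIV and E = "{A. open A \<and> closed A}" and A = "\<lambda>_. UNIV"])
    show "Int_stable {A :: 'x set. open A \<and> closed A}" by (auto simp: Int_stable_def)
    fix A :: "'x set" assume A: "A \<in> {A. open A \<and> closed A}"
    have "\<phi> g \<in> measurable M borel"
      using act_borel_measurable[OF g] measurable_cong_sets[OF M(2) refl] by auto
    then have "emeasure (distr M borel (\<phi> g)) A = emeasure M (\<phi> g -` A)"
      using A by (subst emeasure_distr) (auto simp: spM)
    then show "emeasure (distr M borel (\<phi> g)) A = emeasure M A"
      using A g m(4) M(3) open_vimage_act closed_vimage_act by simp
  qed (use sigma_sets_clopen M(2) g in \<open>auto simp: emeasure_distr\<close>)
  then have inv: "M \<in> invariant_measures G \<phi>"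
    using M unfolding invariant_measures_def by auto
  have "(\<lambda>n. measure M (N n)) \<longlonglongrightarrow> measure M (\<Inter>n. N n)"
    using N M(2) \<open>decseq N\<close> by (intro finite_Lim_measure_decseq) auto
  moreover have "c \<le> measure M (N n)" for n
    using m(1)[of "N n"] m(5)[of n] M(3)[OF N] by (simp add: measure_def)
  ultimately have "c \<le> measure M (\<Inter>n. N n)"
    by (intro LIMSEQ_le_const) auto
  then show False using small[OF inv] by simp
qed

section \<open>Adding towers to a castle\<close>

text \<open>
  A castle is represented by the set of its towers, so that it can be enlarged by a union and needs
  no index set.
\<close>

definition fine_castle :: "'g set \<Rightarrow> real \<Rightarrow> ('g set \<times> 'x set) set \<Rightarrow> bool" where
  "fine_castle K \<delta> \<T> \<longleftrightarrow> castle G \<phi> \<T> fst snd \<and>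
     (\<forall>(S, V)\<in>\<T>. open V \<and> closed V \<and> approx_invariant G K \<delta> S \<and> (\<forall>s\<in>S. diameter (\<phi> s ` V) \<le> \<delta>))"

abbreviation covered :: "('g set \<times> 'x set) set \<Rightarrow> 'x set" where
  "covered \<T> \<equiv> footprint \<phi> \<T> fst snd"

text \<open>
  The clopen sets that can carry a tower of shape \<open>F\<close>, or of any smaller shape, with levels of
  diameter at most \<open>\<delta>\<close>.
\<close>

definition fine_base :: "'g set \<Rightarrow> real \<Rightarrow> 'x set \<Rightarrow> bool" where
  "fine_base F \<delta> U \<longleftrightarrow> open U \<and> closed U \<and> disjoint_family_on (\<lambda>s. \<phi> s ` U) F \<and>
     (\<forall>s\<in>F. diameter (\<phi> s ` U) \<le> \<delta>)"

lemma clopen_image_act: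
  assumes "g \<in> carrier G"
  shows "open A \<Longrightarrow> open (\<phi> g ` A)" and "closed A \<Longrightarrow> closed (\<phi> g ` A)"
  using assms open_vimage_act closed_vimage_act by (simp_all add: image_eq_vimage_inv)

lemma fine_castle_covered_clopen:
  assumes "fine_castle K \<delta> \<T>"
  shows "open (covered \<T>)" and "closed (covered \<T>)"
proof -
  have T: "finite \<T>" "\<And>p. p \<in> \<T> \<Longrightarrow> finite (fst p) \<and> fst p \<subseteq> carrier G \<and> open (snd p) \<and> closed (snd p)"
    using assms unfolding fine_castle_def castle_def tower_def by auto
  show "open (covered \<T>)"
    unfolding footprint_def using T by (intro open_UN ballI clopen_image_act) auto
  show "closed (covered \<T>)"
    unfolding footprint_def using T by (intro closed_UN ballI clopen_image_act) auto
qed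

text \<open>
  The greedy step. The points of \<open>W\<close> are sorted by the set \<open>A\<close> of positions in \<open>F\<close> at which their
  translate is already covered. The points with pattern \<open>A\<close> form a clopen set, over which the tower
  of shape \<open>F - A\<close> is disjoint from what was there before. The new footprint does not depend on
  the patterns: it is the old one together with all of \<open>F W\<close>.
\<close>

lemma add_towers_over_fine_base:
  assumes \<T>: "fine_castle K \<delta> \<T>"
    and F: "F \<subseteq> carrier G" "finite F"
    and shapes: "\<And>A. A \<subseteq> F \<Longrightarrow> real (card A) \<le> \<epsilon> * real (card F) \<Longrightarrow> approx_invariant G K \<delta> (F - A)"
    and U: "fine_base F \<delta> U"
  defines "W \<equiv> {x\<in>U. real (card {s\<in>F. \<phi> s x \<in> covered \<T>}) \<le> \<epsilon> * real (card F)}"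
  obtains \<T>' where "fine_castle K \<delta> \<T>'" "covered \<T>' = covered \<T> \<union> (\<Union>s\<in>F. \<phi> s ` W)"
    "open W" "closed W"
proof -
  let ?C = "covered \<T>"
  let ?hit = "\<lambda>x. {s\<in>F. \<phi> s x \<in> ?C}"
  define \<A> where "\<A> = {A. A \<subseteq> F \<and> real (card A) \<le> \<epsilon> * real (card F)}"
  define V where "V A = {x\<in>U. ?hit x = A}" for A
  have U': "open U" "closed U" "disjoint_family_on (\<lambda>s. \<phi> s ` U) F" "\<And>s. s \<in> F \<Longrightarrow> diameter (\<phi> s ` U) \<le> \<delta>"
    using U unfolding fine_base_def by auto
  have same: "s = t \<and> x = y" if "\<phi> s x = \<phi> t y" "s \<in> F" "t \<in> F" "x \<in> U" "y \<in> U" for s t x y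
  proof -
    have "\<phi> s x \<in> \<phi> s ` U \<inter> \<phi> t ` U" using that by (metis IntI imageI)
    then have "s = t" using U'(3) that unfolding disjoint_family_on_def by blast
    then show ?thesis using that F(1) by auto
  qed
  have clC: "open ?C" "closed ?C" using fine_castle_covered_clopen[OF \<T>] by auto
  have V_clopen: "open (V A) \<and> closed (V A)" if "A \<subseteq> F" for A
  proof -
    have "V A = U \<inter> (\<Inter>s\<in>A. \<phi> s -` ?C) \<inter> (\<Inter>s\<in>F - A. \<phi> s -` (- ?C))"
      using that unfolding V_def by auto
    moreover have "finite A" using that F(2) finite_subset by blast
    ultimately show ?thesis
      using F U'(1,2) clC that
      by (auto intro!: open_Int closed_Int open_INT closed_INT open_vimage_act closed_vimage_act)
  qed
  have "finite \<A>" unfolding \<A>_def using F(2) by simp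
  have W_eq: "W = (\<Union>A\<in>\<A>. V A)"
    unfolding W_def V_def \<A>_def by auto
  \<comment> \<open>The new towers, one for each admissible pattern.\<close>
  define New where "New = (\<lambda>A. (F - A, V A)) ` \<A>"
  have New_level: "\<exists>A\<in>\<A>. p = (F - A, V A) \<and> s \<in> F \<and> s \<notin> A" if "p \<in> New" "s \<in> fst p" for p s
    using that unfolding New_def by auto
  have New_disj: "\<phi> s ` V A \<inter> ?C = {}" if "s \<in> F" "s \<notin> A" for s A
    using that unfolding V_def by auto
  have castle: "castle G \<phi> \<T> fst snd" using \<T> unfolding fine_castle_def by simp
  have "castle G \<phi> (\<T> \<union> New) fst snd"
    unfolding castle_def
  proof (intro conjI ballI)
    show "finite (\<T> \<union> New)" using castle \<open>finite \<A>\<close> unfolding castle_def New_def by auto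
    show disj: "disjoint_family_on (\<lambda>(p, s). \<phi> s ` snd p) (SIGMA p:\<T> \<union> New. fst p)"
      unfolding disjoint_family_on_def
    proof (intro ballI impI)
      fix u v
      assume uv: "u \<in> (SIGMA p:\<T> \<union> New. fst p)" "v \<in> (SIGMA p:\<T> \<union> New. fst p)" "u \<noteq> v"
      obtain S B s where u: "u = ((S, B), s)" by (metis surj_pair)
      obtain T D t where v: "v = ((T, D), t)" by (metis surj_pair)
      have p: "(S, B) \<in> \<T> \<union> New" "s \<in> S" and q: "(T, D) \<in> \<T> \<union> New" "t \<in> T"
        and neq: "S = T \<longrightarrow> B = D \<longrightarrow> s \<noteq> t"
        using uv unfolding u v by auto
      have old: "\<phi> s ` B \<subseteq> ?C" if "(S, B) \<in> \<T>" "s \<in> S" for S B s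
        using that unfolding footprint_def by force
      have new: "\<phi> s ` B \<inter> ?C = {}" if "(S, B) \<in> New" "s \<in> S" for S B s
        using New_level[OF that(1), of s] New_disj that(2) by auto
      consider "(S, B) \<in> \<T>" "(T, D) \<in> \<T>" | "(S, B) \<in> \<T>" "(T, D) \<in> New"
        | "(S, B) \<in> New" "(T, D) \<in> \<T>" | "(S, B) \<in> New" "(T, D) \<in> New"
        using p q by blast
      then have "\<phi> s ` B \<inter> \<phi> t ` D = {}"
      proof cases
        case 1
        then have "((S, B), s) \<in> (SIGMA p:\<T>. fst p)" "((T, D), t) \<in> (SIGMA p:\<T>. fst p)"
          "((S, B), s) \<noteq> ((T, D), t)"
          using p q neq by auto
        then show ?thesis
          using castle unfolding castle_def disjoint_family_on_def by fastforce
      next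
        case 2
        then show ?thesis using old[of S B s] new[of T D t] p q by blast
      next
        case 3
        then show ?thesis using old[of T D t] new[of S B s] p q by blast
      next
        case 4
        then obtain A A' where A: "S = F - A" "B = V A" "s \<in> F" "T = F - A'" "D = V A'" "t \<in> F"
          using New_level[of "(S, B)" s] New_level[of "(T, D)" t] p q by auto
        show ?thesis
        proof (rule ccontr)
          assume "\<phi> s ` B \<inter> \<phi> t ` D \<noteq> {}"
          then obtain x y where xy: "x \<in> B" "y \<in> D" "\<phi> s x = \<phi> t y" by blast
          then have "s = t \<and> x = y" using same A unfolding V_def by auto
          then have "s = t" "A = A'" using xy A unfolding V_def by auto
          then show False using neq A by simp
        qed
      qed
      then show "(case u of (p, s) \<Rightarrow> \<phi> s ` snd p) \<inter> (case v of (p, s) \<Rightarrow> \<phi> s ` snd p) = {}"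
        unfolding u v by simp
    qed
    fix p assume p: "p \<in> \<T> \<union> New"
    have "disjoint_family_on (\<lambda>s. \<phi> s ` snd p) (fst p)"
      unfolding disjoint_family_on_def
    proof (intro ballI impI)
      fix s t assume "s \<in> fst p" "t \<in> fst p" "s \<noteq> t"
      then show "\<phi> s ` snd p \<inter> \<phi> t ` snd p = {}"
        using disjoint_family_onD[OF disj, of "(p, s)" "(p, t)"] p by auto
    qed
    moreover have "fst p \<subseteq> carrier G" "finite (fst p)"
      using p castle F unfolding castle_def tower_def New_def by auto
    ultimately show "tower G \<phi> (fst p) (snd p)"
      unfolding tower_def by blast
  qed
  moreover have level_diam: "diameter (\<phi> s ` V A) \<le> \<delta>" if "s \<in> F" for s A
  proof -
    have "bounded (\<phi> s ` U)"
      using compact_imp_bounded[OF compact_UNIV] bounded_subset by blast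
    then have "diameter (\<phi> s ` V A) \<le> diameter (\<phi> s ` U)"
      by (intro diameter_subset) (auto simp: V_def)
    then show ?thesis using U'(4)[OF that] by linarith
  qed
  moreover have "case p of (S, V) \<Rightarrow> open V \<and> closed V \<and> approx_invariant G K \<delta> S \<and> (\<forall>s\<in>S. diameter (\<phi> s ` V) \<le> \<delta>)"
    if "p \<in> \<T> \<union> New" for p
  proof (cases "p \<in> \<T>")
    case True
    then show ?thesis using \<T> unfolding fine_castle_def by blast
  next
    case False
    then obtain A where "A \<in> \<A>" "p = (F - A, V A)" using \<open>p \<in> \<T> \<union> New\<close> unfolding New_def by blast
    then show ?thesis using V_clopen shapes level_diam unfolding \<A>_def by simp
  qed
  ultimately have "fine_castle K \<delta> (\<T> \<union> New)"
    unfolding fine_castle_def by blast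
  moreover have "covered (\<T> \<union> New) = ?C \<union> (\<Union>s\<in>F. \<phi> s ` W)"
  proof
    show "covered (\<T> \<union> New) \<subseteq> ?C \<union> (\<Union>s\<in>F. \<phi> s ` W)"
    proof
      fix z assume "z \<in> covered (\<T> \<union> New)"
      then obtain p s where p: "p \<in> \<T> \<union> New" "s \<in> fst p" "z \<in> \<phi> s ` snd p"
        unfolding footprint_def by blast
      show "z \<in> ?C \<union> (\<Union>s\<in>F. \<phi> s ` W)"
      proof (cases "p \<in> \<T>")
        case True
        then show ?thesis using p unfolding footprint_def by blast
      next
        case False
        then obtain A where "A \<in> \<A>" "p = (F - A, V A)" "s \<in> F"
          using New_level[of p s] p by blast
        then show ?thesis using p W_eq by auto
      qed
    qed
    show "?C \<union> (\<Union>s\<in>F. \<phi> s ` W) \<subseteq> covered (\<T> \<union> New)"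
    proof
      fix z assume z: "z \<in> ?C \<union> (\<Union>s\<in>F. \<phi> s ` W)"
      show "z \<in> covered (\<T> \<union> New)"
      proof (cases "z \<in> ?C")
        case True
        then show ?thesis unfolding footprint_def by blast
      next
        case False
        then obtain s x where s: "s \<in> F" "x \<in> W" "z = \<phi> s x" using z by blast
        then obtain A where A: "A \<in> \<A>" "x \<in> V A" using W_eq by blast
        then have "s \<in> F - A" using s False unfolding V_def by auto
        then show ?thesis
          using A s unfolding footprint_def New_def by (auto intro!: bexI[of _ A])
      qed
    qed
  qed
  moreover have "open W" "closed W"
    using V_clopen \<open>finite \<A>\<close> unfolding W_eq \<A>_def by (auto intro!: closed_UN)
  ultimately show ?thesis using that by blast
qed

text \<open>
  The new points \<open>\<phi> s w\<close> with \<open>w \<in> W\<close> that were not covered before are disjoint for different \<open>s\<close>,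
  and each \<open>w\<close> contributes at least \<open>(1 - \<epsilon>) * card F\<close> of them.
\<close>

lemma measure_added_towers:
  assumes M: "M \<in> invariant_measures G \<phi>"
    and F: "F \<subseteq> carrier G" "finite F" and disj: "disjoint_family_on (\<lambda>s. \<phi> s ` W) F"
    and sets: "C \<in> sets borel" "W \<in> sets borel"
    and hit: "\<And>x. x \<in> W \<Longrightarrow> real (card {s\<in>F. \<phi> s x \<in> C}) \<le> \<epsilon> * real (card F)"
  shows "(1 - \<epsilon>) * real (card F) * measure M W
    \<le> measure M (C \<union> (\<Union>s\<in>F. \<phi> s ` W)) - measure M C"
proof -
  interpret prob_space M using invariant_prob_space(1)[OF M] .
  note sM = invariant_prob_space(2)[OF M] and spM = invariant_prob_space(3)[OF M]
  have vimage: "\<phi> s -` A \<in> sets borel" if "s \<in> F" "A \<in> sets borel" for s A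
    using measurable_sets[OF act_borel_measurable that(2)] F(1) that(1) by auto
  have image: "\<phi> s ` A \<in> sets borel" if "s \<in> F" "A \<in> sets borel" for s A
    using measurable_sets[OF act_borel_measurable that(2), of "inv s"] F(1) that(1)
    by (auto simp: image_eq_vimage_inv subset_iff)
  have UnF: "(\<Union>s\<in>F. \<phi> s ` W) \<in> sets borel"
    using F(2) image sets(2) by (intro sets.finite_UN) auto
  let ?B = "\<lambda>s. W \<inter> \<phi> s -` (- C)"
  have B: "?B s \<in> sets borel" if "s \<in> F" for s using vimage[OF that] sets by auto
  have "(1 - \<epsilon>) * real (card F) * measure M W = (LINT x|M. (1 - \<epsilon>) * real (card F) * indicator W x)"
    using sets sM spM by simp
  also have "\<dots> \<le> (LINT x|M. real (card {s\<in>F. x \<in> ?B s}))"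
  proof (rule integral_mono)
    show "integrable M (\<lambda>x. (1 - \<epsilon>) * real (card F) * indicator W x :: real)"
      using sets sM emeasure_finite by (simp add: less_top[symmetric])
    show "integrable M (\<lambda>x. real (card {s\<in>F. x \<in> ?B s}))"
      using B sM F by (intro sum_measure_eq_integral_card(1)) auto
    fix x
    show "(1 - \<epsilon>) * real (card F) * indicator W x \<le> real (card {s\<in>F. x \<in> ?B s})"
    proof (cases "x \<in> W")
      case True
      have "{s\<in>F. x \<in> ?B s} = F - {s\<in>F. \<phi> s x \<in> C}" using True by auto
      moreover have "card (F - {s\<in>F. \<phi> s x \<in> C}) = card F - card {s\<in>F. \<phi> s x \<in> C}"
        using F(2) by (intro card_Diff_subset) auto
      moreover have "card {s\<in>F. \<phi> s x \<in> C} \<le> card F" using F(2) by (intro card_mono) auto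
      ultimately show ?thesis using True hit[OF True] by (simp add: algebra_simps)
    qed simp
  qed
  also have "\<dots> = (\<Sum>s\<in>F. measure M (?B s))"
    using B sM F by (intro sum_measure_eq_integral_card(2)[symmetric]) auto
  also have "\<dots> = (\<Sum>s\<in>F. measure M (\<phi> s ` ?B s))"
    using B F M by (intro sum.cong refl invariant_measure_image[symmetric]) auto
  also have "\<dots> = measure M (\<Union>s\<in>F. \<phi> s ` ?B s)"
  proof (rule finite_measure_finite_Union[symmetric])
    show "disjoint_family_on (\<lambda>s. \<phi> s ` ?B s) F"
      using disj by (rule disjoint_family_on_bisimulation) blast
  qed (use F B image sM in auto)
  also have "\<dots> \<le> measure M ((C \<union> (\<Union>s\<in>F. \<phi> s ` W)) - C)"
    using UnF sM sets by (intro finite_measure_mono sets.Diff) auto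
  also have "\<dots> = measure M (C \<union> (\<Union>s\<in>F. \<phi> s ` W)) - measure M C"
    using UnF sM sets by (intro finite_measure_Diff) auto
  finally show ?thesis .
qed

text \<open>
  Since the new footprint is the old one together with the full translates \<open>F w\<close>, \<open>w \<in> W\<close>, a new point that
  \<open>f\<close> moves out has the form \<open>\<phi> s w\<close> with \<open>f s \<notin> F\<close>. The mass of these points is at most
  \<open>\<eta> * card F * measure M W\<close>, which the previous lemma bounds by the mass gained. Charging the
  boundary to the gain makes the errors of successive steps telescope.
\<close>

lemma boundary_of_added_towers:
  assumes M: "M \<in> invariant_measures G \<phi>"
    and F: "F \<subseteq> carrier G" "finite F" and disj: "disjoint_family_on (\<lambda>s. \<phi> s ` W) F"
    and sets: "C \<in> sets borel" "W \<in> sets borel"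
    and hit: "\<And>x. x \<in> W \<Longrightarrow> real (card {s\<in>F. \<phi> s x \<in> C}) \<le> \<epsilon> * real (card F)"
    and \<epsilon>: "\<epsilon> \<le> 1/2"
    and f: "f \<in> carrier G" "real (card ((\<lambda>t. f \<otimes> t) ` F - F)) \<le> \<eta> * real (card F)" "0 \<le> \<eta>"
  defines "C' \<equiv> C \<union> (\<Union>s\<in>F. \<phi> s ` W)"
  shows "measure M (C' - \<phi> f -` C') \<le> measure M (C - \<phi> f -` C) + 2 * \<eta> * (measure M C' - measure M C)"
proof -
  interpret prob_space M using invariant_prob_space(1)[OF M] .
  note sM = invariant_prob_space(2)[OF M] and spM = invariant_prob_space(3)[OF M]
  \<comment> \<open>The positions in \<open>F\<close> that \<open>f\<close> moves out of \<open>F\<close>.\<close>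
  define E where "E = {s\<in>F. f \<otimes> s \<notin> F}"
  have E: "finite E" "E \<subseteq> F" using F unfolding E_def by auto
  have vimage: "\<phi> f -` A \<in> sets borel" if "A \<in> sets borel" for A
    using measurable_sets[OF act_borel_measurable[OF f(1)] that] by simp
  have image: "\<phi> s ` A \<in> sets borel" if "s \<in> F" "A \<in> sets borel" for s A
    using measurable_sets[OF act_borel_measurable that(2), of "inv s"] F(1) that(1)
    by (auto simp: image_eq_vimage_inv subset_iff)
  have "(\<lambda>t. f \<otimes> t) ` F - F = (\<lambda>t. f \<otimes> t) ` E" unfolding E_def by auto
  moreover have "E \<subseteq> carrier G" using E F by blast
  ultimately have cE: "real (card E) \<le> \<eta> * real (card F)"
    using f(2) card_translate[OF f(1)] by metis
  have sub: "C' - \<phi> f -` C' \<subseteq> (C - \<phi> f -` C) \<union> (\<Union>s\<in>E. \<phi> s ` W)"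
  proof
    fix x assume x: "x \<in> C' - \<phi> f -` C'"
    show "x \<in> (C - \<phi> f -` C) \<union> (\<Union>s\<in>E. \<phi> s ` W)"
    proof (cases "x \<in> C")
      case True
      then show ?thesis using x unfolding C'_def by auto
    next
      case False
      then obtain s w where s: "s \<in> F" "w \<in> W" "x = \<phi> s w" using x unfolding C'_def by blast
      have "\<phi> f x = \<phi> (f \<otimes> s) w" using s F(1) f(1) act_mult[of f s w] by auto
      then have "f \<otimes> s \<notin> F" using x s unfolding C'_def by auto
      then show ?thesis using s unfolding E_def by auto
    qed
  qed
  have measE: "(\<Union>s\<in>E. \<phi> s ` W) \<in> sets M" using E image sets sM by auto
  have measD: "C - \<phi> f -` C \<in> sets M" using vimage sets sM by auto
  have "measure M (C' - \<phi> f -` C') \<le> measure M ((C - \<phi> f -` C) \<union> (\<Union>s\<in>E. \<phi> s ` W))"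
    using sub measE measD by (intro finite_measure_mono) auto
  also have "\<dots> \<le> measure M (C - \<phi> f -` C) + measure M (\<Union>s\<in>E. \<phi> s ` W)"
    by (rule measure_Un_le[OF measD measE])
  also have "measure M (\<Union>s\<in>E. \<phi> s ` W) \<le> (\<Sum>s\<in>E. measure M (\<phi> s ` W))"
    using E image sets sM by (intro finite_measure_subadditive_finite) auto
  also have "\<dots> = real (card E) * measure M W"
    using E F M sets by (simp add: invariant_measure_image subset_iff)
  also have "\<dots> \<le> \<eta> * real (card F) * measure M W"
    using cE by (intro mult_right_mono) auto
  also have "\<dots> = 2 * \<eta> * ((1/2) * real (card F) * measure M W)"
    by simp
  also have "\<dots> \<le> 2 * \<eta> * ((1 - \<epsilon>) * real (card F) * measure M W)"
    using \<epsilon> f(3) by (intro mult_left_mono mult_right_mono) auto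
  also have "\<dots> \<le> 2 * \<eta> * (measure M C' - measure M C)"
    using measure_added_towers[OF M F disj sets hit] f(3) unfolding C'_def
    by (intro mult_left_mono) auto
  finally show ?thesis by simp
qed

text \<open>
  One full round: the greedy step over each of the sets in \<open>\<U>\<close> in turn. A point of \<open>U\<close> that receives
  no tower has more than the proportion \<open>\<epsilon>\<close> of its \<open>F\<close>-orbit covered already, and a point that does
  receive one has its whole \<open>F\<close>-orbit covered; neither is destroyed later.
\<close>

lemma add_towers_over_fine_bases:
  assumes "finite \<U>" and \<U>: "\<And>U. U \<in> \<U> \<Longrightarrow> fine_base F \<delta> U"
    and \<T>: "fine_castle K \<delta> \<T>"
    and F: "F \<subseteq> carrier G" "finite F"
    and \<epsilon>: "\<epsilon> \<le> 1/2"
    and shapes: "\<And>A. A \<subseteq> F \<Longrightarrow> real (card A) \<le> \<epsilon> * real (card F) \<Longrightarrow> approx_invariant G K \<delta> (F - A)"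
    and \<eta>: "0 \<le> \<eta>" and L: "L \<subseteq> carrier G"
      "\<And>f. f \<in> L \<Longrightarrow> real (card ((\<lambda>t. f \<otimes> t) ` F - F)) \<le> \<eta> * real (card F)"
  shows "\<exists>\<T>'. fine_castle K \<delta> \<T>' \<and> covered \<T> \<subseteq> covered \<T>' \<and>
    (\<forall>U\<in>\<U>. \<forall>x\<in>U. \<epsilon> * real (card F) \<le> real (card {s\<in>F. \<phi> s x \<in> covered \<T>'})) \<and>
    (\<forall>M\<in>invariant_measures G \<phi>. \<forall>f\<in>L.
      measure M (covered \<T>' - \<phi> f -` covered \<T>')
      \<le> measure M (covered \<T> - \<phi> f -` covered \<T>) + 2 * \<eta> * (measure M (covered \<T>') - measure M (covered \<T>)))"
    (is "\<exists>\<T>'. ?extends \<U> \<T>'")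
  using assms(1) \<U>
proof (induction \<U>)
  case empty
  show ?case using \<T> by (intro exI[of _ \<T>]) auto
next
  case (insert U \<U>)
  have "\<exists>\<T>1. ?extends \<U> \<T>1"
    by (rule insert.IH) (rule insert.prems, rule insertI2)
  then obtain \<T>1 where T1: "fine_castle K \<delta> \<T>1" "covered \<T> \<subseteq> covered \<T>1"
    "\<forall>U\<in>\<U>. \<forall>x\<in>U. \<epsilon> * real (card F) \<le> real (card {s\<in>F. \<phi> s x \<in> covered \<T>1})"
    "\<forall>M\<in>invariant_measures G \<phi>. \<forall>f\<in>L.
      measure M (covered \<T>1 - \<phi> f -` covered \<T>1)
      \<le> measure M (covered \<T> - \<phi> f -` covered \<T>) + 2 * \<eta> * (measure M (covered \<T>1) - measure M (covered \<T>))"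
    by (elim exE conjE) assumption+
  have U: "fine_base F \<delta> U" using insert.prems by simp
  define W where "W = {x\<in>U. real (card {s\<in>F. \<phi> s x \<in> covered \<T>1}) \<le> \<epsilon> * real (card F)}"
  obtain \<T>' where T': "fine_castle K \<delta> \<T>'" "covered \<T>' = covered \<T>1 \<union> (\<Union>s\<in>F. \<phi> s ` W)"
    and W: "open W" "closed W"
    unfolding W_def by (rule add_towers_over_fine_base[OF T1(1) F shapes U])
  have "disjoint_family_on (\<lambda>s. \<phi> s ` W) F"
    using U unfolding fine_base_def disjoint_family_on_def W_def by blast
  moreover have "covered \<T>1 \<in> sets borel" "W \<in> sets borel"
    using W fine_castle_covered_clopen[OF T1(1)] by auto
  ultimately have bd: "measure M (covered \<T>' - \<phi> f -` covered \<T>')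
      \<le> measure M (covered \<T>1 - \<phi> f -` covered \<T>1) + 2 * \<eta> * (measure M (covered \<T>') - measure M (covered \<T>1))"
    if "M \<in> invariant_measures G \<phi>" "f \<in> L" for M f
    unfolding T'(2) using F \<epsilon> L that \<eta>
    by (intro boundary_of_added_towers) (auto simp: W_def)
  have "\<epsilon> * real (card F) \<le> real (card {s\<in>F. \<phi> s x \<in> covered \<T>'})"
    if "U' \<in> insert U \<U>" "x \<in> U'" for U' x
  proof -
    have mono: "card {s\<in>F. \<phi> s x \<in> covered \<T>1} \<le> card {s\<in>F. \<phi> s x \<in> covered \<T>'}"
      using F(2) T'(2) by (intro card_mono) auto
    consider "U' \<in> \<U>" | "x \<in> U" "x \<notin> W" | "x \<in> W" using \<open>U' \<in> insert U \<U>\<close> \<open>x \<in> U'\<close> by blast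
    then show ?thesis
    proof cases
      case 1
      then show ?thesis using T1(3) 1 \<open>x \<in> U'\<close> mono by force
    next
      case 2
      then show ?thesis using mono unfolding W_def by simp
    next
      case 3
      then have "{s\<in>F. \<phi> s x \<in> covered \<T>'} = F" using T'(2) by auto
      moreover have "\<epsilon> * real (card F) \<le> 1 * real (card F)"
        using \<epsilon> by (intro mult_right_mono) auto
      ultimately show ?thesis by simp
    qed
  qed
  moreover have "measure M (covered \<T>' - \<phi> f -` covered \<T>')
      \<le> measure M (covered \<T> - \<phi> f -` covered \<T>) + 2 * \<eta> * (measure M (covered \<T>') - measure M (covered \<T>))"
    if "M \<in> invariant_measures G \<phi>" "f \<in> L" for M f
    using bd[OF that] bspec[OF bspec[OF T1(4) that(1)] that(2)] by (simp add: algebra_simps)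
  moreover have "covered \<T> \<subseteq> covered \<T>'" using T1(2) T'(2) by blast
  ultimately show ?case using T'(1) by blast
qed

section \<open>Covering the free part\<close>

text \<open>
  Where the points \<open>\<phi> s x\<close>, \<open>s \<in> F\<close>, are distinct, small balls around them are disjoint, and by
  continuity a small clopen neighbourhood of \<open>x\<close> is mapped into them.
\<close>

lemma fine_base_neighbourhood:
  assumes F: "F \<subseteq> carrier G" "finite F" and "0 < \<delta>"
    and inj: "inj_on (\<lambda>s. \<phi> s x) F" and W: "open W" "x \<in> W"
  shows "\<exists>U. fine_base F \<delta> U \<and> x \<in> U \<and> U \<subseteq> W"
proof -
  \<comment> \<open>Balls of radius \<open>r / 2\<close> are disjoint and have diameter at most \<open>\<delta>\<close>; including \<open>\<delta>\<close> also makes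
    \<open>R\<close> nonempty.\<close>
  define R where "R = insert \<delta> ((\<lambda>(s, t). dist (\<phi> s x) (\<phi> t x)) ` {(s, t)\<in>F \<times> F. s \<noteq> t})"
  have "finite {(s, t)\<in>F \<times> F. s \<noteq> t}"
    using F(2) by (auto intro: finite_subset[of _ "F \<times> F"])
  then have R: "finite R" "R \<noteq> {}" unfolding R_def by blast+
  define r where "r = Min R"
  have "0 < \<rho>" if "\<rho> \<in> R" for \<rho>
    using that \<open>0 < \<delta>\<close> inj unfolding R_def inj_on_def by auto
  then have "0 < r" unfolding r_def using R by simp
  have "r \<le> \<delta>" unfolding r_def using R by (simp add: R_def)
  have r_dist: "r \<le> dist (\<phi> s x) (\<phi> t x)" if "s \<in> F" "t \<in> F" "s \<noteq> t" for s t
    unfolding r_def by (rule Min_le[OF R(1)]) (use that in \<open>auto simp: R_def\<close>)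
  have nbhd: "open (W \<inter> (\<Inter>s\<in>F. \<phi> s -` ball (\<phi> s x) (r / 2)))"
    using W F by (intro open_Int open_INT ballI open_vimage_act) auto
  have "x \<in> W \<inter> (\<Inter>s\<in>F. \<phi> s -` ball (\<phi> s x) (r / 2))"
    using W \<open>0 < r\<close> by auto
  from clopen_basis[OF nbhd this] obtain U where U: "open U" "closed U" "x \<in> U"
    and U_sub: "U \<subseteq> W \<inter> (\<Inter>s\<in>F. \<phi> s -` ball (\<phi> s x) (r / 2))"
    by (elim exE conjE)
  have near: "dist (\<phi> s x) (\<phi> s y) < r / 2" if "s \<in> F" "y \<in> U" for s y
  proof -
    have "y \<in> \<phi> s -` ball (\<phi> s x) (r / 2)" using U_sub that by blast
    then show ?thesis by simp
  qed
  have "\<phi> s ` U \<inter> \<phi> t ` U = {}" if st: "s \<in> F" "t \<in> F" "s \<noteq> t" for s t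
  proof (rule ccontr)
    assume "\<phi> s ` U \<inter> \<phi> t ` U \<noteq> {}"
    then obtain y z where yz: "y \<in> U" "z \<in> U" "\<phi> s y = \<phi> t z" by blast
    have "dist (\<phi> s x) (\<phi> t x) \<le> dist (\<phi> s x) (\<phi> s y) + dist (\<phi> t x) (\<phi> t z)"
      using yz(3) by (metis dist_triangle2)
    then show False
      using near[OF st(1) yz(1)] near[OF st(2) yz(2)] r_dist[OF st] by linarith
  qed
  then have "disjoint_family_on (\<lambda>s. \<phi> s ` U) F" unfolding disjoint_family_on_def by blast
  moreover have "diameter (\<phi> s ` U) \<le> \<delta>" if "s \<in> F" for s
  proof -
    have "dist (\<phi> s y) (\<phi> s z) \<le> \<delta>" if "y \<in> U" "z \<in> U" for y z
    proof -
      have "dist (\<phi> s y) (\<phi> s z) \<le> dist (\<phi> s x) (\<phi> s y) + dist (\<phi> s x) (\<phi> s z)"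
        by (metis dist_triangle3)
      then show ?thesis
        using near[OF \<open>s \<in> F\<close> that(1)] near[OF \<open>s \<in> F\<close> that(2)] \<open>r \<le> \<delta>\<close> by linarith
    qed
    moreover have "U \<noteq> {}" using U(3) by blast
    ultimately show ?thesis
      unfolding diameter_def by (auto intro!: cSUP_least)
  qed
  ultimately have "fine_base F \<delta> U" unfolding fine_base_def using U by simp
  then show ?thesis using U(3) U_sub by blast
qed

lemma open_free_points:
  assumes F: "F \<subseteq> carrier G" "finite F"
  shows "open {x. inj_on (\<lambda>s. \<phi> s x) F}"
proof -
  have "{x. inj_on (\<lambda>s. \<phi> s x) F} = (\<Inter>(s, t)\<in>{(s, t)\<in>F \<times> F. s \<noteq> t}. - {x. \<phi> s x = \<phi> t x})"
    by (auto simp: inj_on_def)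
  moreover have "closed {x. \<phi> s x = \<phi> t x}" if "s \<in> F" "t \<in> F" for s t
    using F that by (intro closed_Collect_eq act_continuous) auto
  moreover have "finite {(s, t)\<in>F \<times> F. s \<noteq> t}"
    using F(2) by (auto intro: finite_subset[of _ "F \<times> F"])
  ultimately show ?thesis by (auto intro!: open_INT)
qed

text \<open>
  If \<open>\<phi> s x = \<phi> t x\<close> with \<open>s \<noteq> t\<close> then \<open>x\<close> is fixed by \<open>inv s \<otimes> t \<noteq> \<one>\<close>.
\<close>

lemma measure_nonfree_points:
  assumes "essentially_free G \<phi>" and M: "M \<in> invariant_measures G \<phi>"
    and F: "F \<subseteq> carrier G" "finite F"
  shows "measure M {x. \<not> inj_on (\<lambda>s. \<phi> s x) F} = 0"
proof -
  interpret prob_space M using invariant_prob_space(1)[OF M] .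
  note sM = invariant_prob_space(2)[OF M]
  define P where "P = {(s, t)\<in>F \<times> F. s \<noteq> t}"
  have P: "finite P" unfolding P_def using F(2) by (auto intro: finite_subset[of _ "F \<times> F"])
  let ?Fix = "\<lambda>(s, t). {x. \<phi> (inv s \<otimes> t) x = x}"
  have sub: "{x. \<not> inj_on (\<lambda>s. \<phi> s x) F} \<subseteq> (\<Union>p\<in>P. ?Fix p)"
  proof
    fix x assume "x \<in> {x. \<not> inj_on (\<lambda>s. \<phi> s x) F}"
    then obtain s t where st: "s \<in> F" "t \<in> F" "s \<noteq> t" "\<phi> s x = \<phi> t x"
      unfolding inj_on_def by auto
    then have "\<phi> (inv s \<otimes> t) x = x"
      using F(1) by (metis act_inv(1) act_mult inv_closed subsetD)
    then show "x \<in> (\<Union>p\<in>P. ?Fix p)" using st unfolding P_def by auto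
  qed
  have null: "measure M (?Fix p) = 0" if "p \<in> P" for p
  proof -
    obtain s t where p: "p = (s, t)" "s \<in> F" "t \<in> F" "s \<noteq> t" using \<open>p \<in> P\<close> unfolding P_def by auto
    then have st: "s \<in> carrier G" "t \<in> carrier G" using F(1) by auto
    then have "inv s \<otimes> t \<noteq> \<one>"
      using inv_solve_left[OF one_closed st] p(4) by (metis r_one)
    then have "inv s \<otimes> t \<in> carrier G - {\<one>}" using st by simp
    then show ?thesis using assms(1) M p(1) unfolding essentially_free_def by simp
  qed
  have meas: "?Fix p \<in> sets M" if p: "p \<in> P" for p
  proof -
    have "closed {x. \<phi> g x = x}" if "g \<in> carrier G" for g
      using that by (intro closed_Collect_eq act_continuous continuous_on_id)
    then show ?thesis using F p sM unfolding P_def by (auto simp: subset_iff)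
  qed
  have "measure M {x. \<not> inj_on (\<lambda>s. \<phi> s x) F} \<le> measure M (\<Union>p\<in>P. ?Fix p)"
    using sub meas P by (intro finite_measure_mono sets.finite_UN) auto
  also have "\<dots> \<le> (\<Sum>p\<in>P. measure M (?Fix p))"
    using meas P by (intro finite_measure_subadditive_finite) auto
  also have "\<dots> = 0" using null by simp
  finally show ?thesis by (simp add: measure_le_0_iff)
qed

text \<open>
  The free part is exhausted by finite unions of such neighbourhoods, and the complements of these
  unions decrease to a null set. That a single one of the unions works for all invariant measures
  comes from passing to frequencies: a uniform bound on the frequency of visits along one finite set
  integrates to the same bound on every invariant measure.
\<close>

lemma fine_bases_cover_up_to_small_measure:
  assumes "amenable_group G" and "essentially_free G \<phi>"
    and F: "F \<subseteq> carrier G" "finite F" and "0 < \<delta>" and "0 < \<eta>"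
  shows "\<exists>\<U>. finite \<U> \<and> (\<forall>U\<in>\<U>. fine_base F \<delta> U) \<and>
    (\<forall>M\<in>invariant_measures G \<phi>. measure M (- \<Union>\<U>) \<le> \<eta>)"
proof -
  let ?free = "{x. inj_on (\<lambda>s. \<phi> s x) F}"
  have "\<exists>B\<in>{U. fine_base F \<delta> U}. open B \<and> x \<in> B \<and> B \<subseteq> ?free" if "x \<in> ?free" for x
    using fine_base_neighbourhood[OF F \<open>0 < \<delta>\<close> _ open_free_points[OF F] that] that
    unfolding fine_base_def by blast
  from open_exhaustion_by_finite_subfamilies[OF compact_UNIV open_free_points[OF F] this]
  obtain \<U> where \<U>: "\<And>n::nat. finite (\<U> n)" "\<And>n. \<U> n \<subseteq> {U. fine_base F \<delta> U}" "mono \<U>"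
    "(\<Union>n. \<Union>(\<U> n)) = ?free"
    by blast
  define N where "N n = - \<Union>(\<U> n)" for n
  have N: "open (N n)" "closed (N n)" for n
  proof -
    have "open U" "closed U" if "U \<in> \<U> n" for U
      using \<U>(2)[of n] that unfolding fine_base_def by auto
    then show "open (N n)" "closed (N n)"
      unfolding N_def using \<U>(1)[of n] by (auto intro!: open_Compl closed_Compl closed_Union open_Union)
  qed
  have N_dec: "decseq N"
    unfolding N_def decseq_def using monoD[OF \<U>(3)] by blast
  have "(\<Inter>n. N n) = {x. \<not> inj_on (\<lambda>s. \<phi> s x) F}"
    unfolding N_def using \<U>(4) by blast
  then have N_null: "measure M (\<Inter>n. N n) < \<eta>" if "M \<in> invariant_measures G \<phi>" for M
    using measure_nonfree_points[OF assms(2) that F] \<open>0 < \<eta>\<close> by simp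
  obtain n E where E: "E \<subseteq> carrier G" "finite E" "E \<noteq> {}"
    and rare: "\<And>x. real (card {t\<in>E. \<phi> t x \<in> N n}) < \<eta> * real (card E)"
    by (rule uniformly_small_frequency[OF assms(1) N_dec N N_null]) auto
  have "measure M (N n) \<le> \<eta>" if M: "M \<in> invariant_measures G \<phi>" for M
  proof -
    interpret prob_space M using invariant_prob_space(1)[OF M] .
    note sM = invariant_prob_space(2)[OF M]
    have B: "\<phi> t -` N n \<in> sets M" if "t \<in> E" for t
      using open_vimage_act[of t "N n"] N that E(1) sM by auto
    have "real (card E) * measure M (N n) = (\<Sum>t\<in>E. measure M (\<phi> t -` N n))"
      using E M N by (simp add: invariant_measure_vimage subset_iff)
    also have "\<dots> = (LINT x|M. real (card {t\<in>E. x \<in> \<phi> t -` N n}))"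
      using B E by (intro sum_measure_eq_integral_card(2)) auto
    also have "\<dots> \<le> (LINT x|M. \<eta> * real (card E))"
    proof (rule integral_mono)
      show "integrable M (\<lambda>x. real (card {t\<in>E. x \<in> \<phi> t -` N n}))"
        using B E by (intro sum_measure_eq_integral_card(1)) auto
      show "real (card {t\<in>E. x \<in> \<phi> t -` N n}) \<le> \<eta> * real (card E)" for x
        using rare[of x] by simp
    qed simp
    also have "\<dots> = \<eta> * real (card E)" using prob_space by simp
    finally show ?thesis using E by (simp add: card_gt_0_iff mult.commute)
  qed
  then show ?thesis
    using \<U>(1)[of n] \<U>(2)[of n] unfolding N_def by (intro exI[of _ "\<U> n"]) auto
qed

section \<open>Castles that are large for every invariant measure\<close>

text \<open>
  Integrate over \<open>x\<close> the number of \<open>s \<in> F\<close> with \<open>\<phi> s x \<in> C'\<close>; by invariance this is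
  \<open>card F * measure M C'\<close>. The number is at least \<open>\<epsilon> * card F\<close> off \<open>N\<close>, and it is \<open>card F\<close> on the set
  \<open>D\<close> of those points of \<open>C\<close> that no element of \<open>F\<close> moves out of \<open>C\<close>, which is almost all of
  \<open>C\<close>.
\<close>

lemma measure_gain_from_hits:
  assumes M: "M \<in> invariant_measures G \<phi>"
    and F: "F \<subseteq> carrier G" "finite F" "F \<noteq> {}"
    and sets: "C \<in> sets borel" "C' \<in> sets borel" "N \<in> sets borel" and "C \<subseteq> C'"
    and \<epsilon>: "0 \<le> \<epsilon>" "\<epsilon> \<le> 1"
    and hit: "\<And>x. x \<notin> N \<Longrightarrow> \<epsilon> * real (card F) \<le> real (card {s\<in>F. \<phi> s x \<in> C'})"
    and boundary: "\<And>f. f \<in> F \<Longrightarrow> measure M (C - \<phi> f -` C) \<le> \<eta>"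
    and N: "measure M N \<le> \<eta>"
  shows "1 - measure M C' \<le> (1 - \<epsilon>) * (1 - measure M C) + (real (card F) + 1) * \<eta>"
proof -
  interpret prob_space M using invariant_prob_space(1)[OF M] .
  note sM = invariant_prob_space(2)[OF M] and spM = invariant_prob_space(3)[OF M]
  have cF: "real (card F) > 0" using F by (simp add: card_gt_0_iff)
  have "0 \<le> \<eta>" using N measure_nonneg order_trans by blast
  have vimage: "\<phi> f -` A \<in> sets M" if "f \<in> F" "A \<in> sets borel" for f A
    using measurable_sets[OF act_borel_measurable that(2)] F(1) that(1) sM by auto
  define B where "B = (\<Union>f\<in>F. C - \<phi> f -` C)"
  define D where "D = C - B"
  have Bf: "C - \<phi> f -` C \<in> sets M" if "f \<in> F" for f using vimage[OF that] sets sM by auto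
  then have B: "B \<in> sets M" unfolding B_def using F(2) by (intro sets.finite_UN) auto
  then have D: "D \<in> sets M" unfolding D_def using sets sM by auto
  have "measure M B \<le> (\<Sum>f\<in>F. measure M (C - \<phi> f -` C))"
    unfolding B_def using Bf F(2) by (intro finite_measure_subadditive_finite) auto
  also have "\<dots> \<le> real (card F) * \<eta>" using sum_mono[OF boundary] by simp
  finally have mB: "measure M B \<le> real (card F) * \<eta>" .
  have "measure M C \<le> measure M (D \<union> B)"
    by (rule finite_measure_mono[OF _ sets.Un[OF D B]]) (auto simp: D_def)
  also have "\<dots> \<le> measure M D + measure M B" by (rule measure_Un_le[OF D B])
  finally have mD: "measure M C - real (card F) * \<eta> \<le> measure M D" using mB by linarith
  define g where "g x = real (card F) * (\<epsilon> + (1 - \<epsilon>) * indicator D x - \<epsilon> * indicator N x)" for x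
  have int: "integrable M (indicator A :: _ \<Rightarrow> real)" if "A \<in> sets M" for A
    using that emeasure_finite by (simp add: less_top[symmetric])
  note intDN = int[OF D] int[of N]
  have "real (card F) * (\<epsilon> + (1 - \<epsilon>) * measure M D - \<epsilon> * measure M N) = (LINT x|M. g x)"
    unfolding g_def using D sets sM spM intDN prob_space by (simp add: sets.Int_space_eq2)
  also have "\<dots> \<le> (LINT x|M. real (card {s\<in>F. x \<in> \<phi> s -` C'}))"
  proof (rule integral_mono)
    show "integrable M g" unfolding g_def using intDN sets sM by simp
    show "integrable M (\<lambda>x. real (card {s\<in>F. x \<in> \<phi> s -` C'}))"
      using vimage sets F by (intro sum_measure_eq_integral_card(1)) auto
    fix x
    consider "x \<in> D" | "x \<notin> D" "x \<in> N" | "x \<notin> D" "x \<notin> N" by blast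
    then show "g x \<le> real (card {s\<in>F. x \<in> \<phi> s -` C'})"
    proof cases
      case 1
      have "{s\<in>F. x \<in> \<phi> s -` C'} = F" using 1 \<open>C \<subseteq> C'\<close> unfolding D_def B_def by auto
      moreover have "g x \<le> real (card F) * 1"
        unfolding g_def using 1 \<epsilon> by (intro mult_left_mono) (auto simp: indicator_def)
      ultimately show ?thesis by simp
    next
      case 2
      then show ?thesis unfolding g_def by simp
    next
      case 3
      then show ?thesis unfolding g_def using hit[OF 3(2)] by (simp add: mult.commute)
    qed
  qed
  also have "\<dots> = (\<Sum>s\<in>F. measure M (\<phi> s -` C'))"
    using vimage sets F by (intro sum_measure_eq_integral_card(2)[symmetric]) auto
  also have "\<dots> = real (card F) * measure M C'"
    using F M sets by (simp add: invariant_measure_vimage subset_iff)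
  finally have "\<epsilon> + (1 - \<epsilon>) * measure M D - \<epsilon> * measure M N \<le> measure M C'"
    using cF by simp
  moreover have "(1 - \<epsilon>) * (measure M C - real (card F) * \<eta>) \<le> (1 - \<epsilon>) * measure M D"
    using mD \<epsilon> by (intro mult_left_mono) auto
  moreover have "\<epsilon> * measure M N \<le> 1 * \<eta>"
    using \<epsilon> N by (intro mult_mono) auto
  moreover have "(1 - \<epsilon>) * (real (card F) * \<eta>) \<le> 1 * (real (card F) * \<eta>)"
    using \<epsilon> \<open>0 \<le> \<eta>\<close> by (intro mult_right_mono) auto
  ultimately show ?thesis by (simp add: algebra_simps)
qed

text \<open>
  The rounds of the tiling. The next set \<open>F\<close> is chosen first, and the castle from the induction
  hypothesis is required to be almost invariant under \<open>L \<union> F\<close>: invariance under \<open>F\<close> gives the gain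
  in measure, and invariance under \<open>L\<close> is passed on.
\<close>

lemma fine_castle_of_large_measure:
  assumes "amenable_group G" and "essentially_free G \<phi>"
    and K: "K \<subseteq> carrier G" "finite K" "K \<noteq> {}"
    and \<epsilon>: "0 < \<epsilon>" "\<epsilon> \<le> 1/2" "4 * (real (card K) + 1) * \<epsilon> < \<delta>"
    and "L \<subseteq> carrier G" "finite L" and "0 < \<eta>"
  shows "\<exists>\<T>. fine_castle K \<delta> \<T> \<and> (\<forall>M\<in>invariant_measures G \<phi>.
      1 - measure M (covered \<T>) \<le> (1 - \<epsilon>) ^ n + \<eta> \<and>
      (\<forall>f\<in>L. measure M (covered \<T> - \<phi> f -` covered \<T>) \<le> \<eta>))"
  using assms(9-)
proof (induction n arbitrary: L \<eta>)
  case 0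
  have "fine_castle K \<delta> {}"
    unfolding fine_castle_def castle_def by (simp add: disjoint_family_on_def)
  moreover have "covered {} = {}" unfolding footprint_def by simp
  ultimately show ?case using 0 by (intro exI[of _ "{}"]) auto
next
  case (Suc n)
  have "0 < \<delta>" using \<epsilon> by (smt (verit) mult_nonneg_nonneg of_nat_0_le_iff)
  \<comment> \<open>\<open>\<eta>1\<close> bounds the boundary of \<open>F\<close>: at most \<open>\<epsilon>\<close> so that trimmed copies of \<open>F\<close> are still
    invariant under \<open>K\<close>, and at most \<open>\<eta> / 4\<close> so that it contributes at most half of \<open>\<eta>\<close> to the
    boundary of the footprint.\<close>
  define \<eta>1 where "\<eta>1 = min \<epsilon> (\<eta> / 4)"
  have \<eta>1: "0 < \<eta>1" "\<eta>1 \<le> \<epsilon>" "4 * \<eta>1 \<le> \<eta>" unfolding \<eta>1_def using \<epsilon> Suc.prems by auto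
  have KL: "K \<union> L \<subseteq> carrier G" "finite (K \<union> L)" "K \<union> L \<noteq> {}" using K Suc.prems by auto
  then obtain F where F0: "approx_invariant G (K \<union> L) \<eta>1 F"
    using assms(1) \<eta>1(1) unfolding amenable_group_def by metis
  then have F: "F \<subseteq> carrier G" "finite F" "F \<noteq> {}" unfolding approx_invariant_def by auto
  have F_inv: "real (card ((\<lambda>t. k \<otimes> t) ` F - F)) \<le> \<eta>1 * real (card F)" if "k \<in> K \<union> L" for k
    using approx_invariant_translate[OF F0 that KL(1,2)] .
  have F_inv': "real (card ((\<lambda>t. k \<otimes> t) ` F - F)) \<le> \<epsilon> * real (card F)" if "k \<in> K" for k
    using F_inv[of k] that mult_right_mono[OF \<eta>1(2), of "real (card F)"] by simp
  have shapes: "approx_invariant G K \<delta> (F - A)" if "A \<subseteq> F" "real (card A) \<le> \<epsilon> * real (card F)" for A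
    using approx_invariant_remove_few[OF K F F_inv' that] \<epsilon> by simp
  \<comment> \<open>The tolerance for the smaller castle depends on \<open>F\<close>, because the error is summed over \<open>F\<close>.\<close>
  define \<eta>2 where "\<eta>2 = \<eta> / (2 * (real (card F) + 2))"
  have \<eta>2: "0 < \<eta>2" unfolding \<eta>2_def using Suc.prems by (simp add: add_nonneg_pos)
  have \<eta>2_eq: "2 * ((real (card F) + 2) * \<eta>2) = \<eta>"
  proof -
    have "real (card F) + 2 \<noteq> 0" by linarith
    then show ?thesis unfolding \<eta>2_def by (simp add: divide_simps)
  qed
  have \<eta>2_le: "(real (card F) + 2) * \<eta>2 \<le> \<eta>" "2 * \<eta>2 \<le> \<eta>"
  proof -
    show "(real (card F) + 2) * \<eta>2 \<le> \<eta>" using \<eta>2_eq Suc.prems by linarith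
    have "1 * \<eta>2 \<le> (real (card F) + 2) * \<eta>2" using \<eta>2 by (intro mult_right_mono) auto
    then show "2 * \<eta>2 \<le> \<eta>" using \<eta>2_eq by linarith
  qed
  have "L \<union> F \<subseteq> carrier G" "finite (L \<union> F)" using Suc.prems F by auto
  from Suc.IH[OF this \<eta>2] obtain \<T>0 where T0: "fine_castle K \<delta> \<T>0"
    and T0_meas: "\<And>M. M \<in> invariant_measures G \<phi> \<Longrightarrow> 1 - measure M (covered \<T>0) \<le> (1 - \<epsilon>) ^ n + \<eta>2"
    and T0_bd: "\<And>M f. M \<in> invariant_measures G \<phi> \<Longrightarrow> f \<in> L \<union> F \<Longrightarrow>
      measure M (covered \<T>0 - \<phi> f -` covered \<T>0) \<le> \<eta>2"
    by blast
  obtain \<U> where \<U>: "finite \<U>" "\<And>U. U \<in> \<U> \<Longrightarrow> fine_base F \<delta> U"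
    "\<And>M. M \<in> invariant_measures G \<phi> \<Longrightarrow> measure M (- \<Union>\<U>) \<le> \<eta>2"
    using fine_bases_cover_up_to_small_measure[OF assms(1,2) F(1,2) \<open>0 < \<delta>\<close> \<eta>2] by blast
  have F_invL: "real (card ((\<lambda>t. f \<otimes> t) ` F - F)) \<le> \<eta>1 * real (card F)" if "f \<in> L" for f
    using F_inv that by simp
  obtain \<T> where T: "fine_castle K \<delta> \<T>" "covered \<T>0 \<subseteq> covered \<T>"
    and hit: "\<forall>U\<in>\<U>. \<forall>x\<in>U. \<epsilon> * real (card F) \<le> real (card {s\<in>F. \<phi> s x \<in> covered \<T>})"
    and bd: "\<forall>M\<in>invariant_measures G \<phi>. \<forall>f\<in>L.
      measure M (covered \<T> - \<phi> f -` covered \<T>)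
      \<le> measure M (covered \<T>0 - \<phi> f -` covered \<T>0) + 2 * \<eta>1 * (measure M (covered \<T>) - measure M (covered \<T>0))"
    by (rule exE[OF add_towers_over_fine_bases[OF \<U>(1,2) T0 F(1,2) \<epsilon>(2) shapes
            less_imp_le[OF \<eta>1(1)] Suc.prems(1) F_invL]])
      (assumption | elim conjE, rule that)+
  have "1 - measure M (covered \<T>) \<le> (1 - \<epsilon>) ^ Suc n + \<eta>" if M: "M \<in> invariant_measures G \<phi>" for M
  proof -
    have "- \<Union>\<U> \<in> sets borel" using \<U>(2) unfolding fine_base_def
      by (intro borel_open open_Compl closed_Union \<U>(1)) auto
    moreover have "covered \<T>0 \<in> sets borel" "covered \<T> \<in> sets borel"
      using fine_castle_covered_clopen T0 T(1) by auto
    ultimately have "1 - measure M (covered \<T>)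
        \<le> (1 - \<epsilon>) * (1 - measure M (covered \<T>0)) + (real (card F) + 1) * \<eta>2"
      using \<epsilon> hit T(2) T0_bd M \<U>(3)
      by (intro measure_gain_from_hits[OF M F, where N = "- \<Union>\<U>"]) auto
    also have "(1 - \<epsilon>) * (1 - measure M (covered \<T>0)) \<le> (1 - \<epsilon>) * ((1 - \<epsilon>) ^ n + \<eta>2)"
      using T0_meas[OF M] \<epsilon> by (intro mult_left_mono) auto
    also have "\<dots> \<le> (1 - \<epsilon>) ^ Suc n + \<eta>2"
      using \<epsilon> \<eta>2 by (simp add: algebra_simps)
    finally have "1 - measure M (covered \<T>) \<le> (1 - \<epsilon>) ^ Suc n + (real (card F) + 2) * \<eta>2"
      by (simp add: algebra_simps)
    then show ?thesis using \<eta>2_le(1) by linarith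
  qed
  moreover have "measure M (covered \<T> - \<phi> f -` covered \<T>) \<le> \<eta>"
    if M: "M \<in> invariant_measures G \<phi>" and f: "f \<in> L" for M f
  proof -
    interpret prob_space M using invariant_prob_space(1)[OF M] .
    have "measure M (covered \<T>) - measure M (covered \<T>0) \<le> 1"
      using prob_le_1[of "covered \<T>"] measure_nonneg[of M "covered \<T>0"] by linarith
    then have "2 * \<eta>1 * (measure M (covered \<T>) - measure M (covered \<T>0)) \<le> 2 * \<eta>1 * 1"
      using \<eta>1 by (intro mult_left_mono) auto
    moreover have "measure M (covered \<T>0 - \<phi> f -` covered \<T>0) \<le> \<eta>2" using T0_bd M f by blast
    ultimately show ?thesis
      using bspec[OF bspec[OF bd M] f] \<eta>1 \<eta>2_le by linarith
  qed
  ultimately show ?case using T(1) by blast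
qed

section \<open>Almost finiteness in measure\<close>

lemma lower_banach_density_ge:
  assumes "F \<subseteq> carrier G" "finite F" "F \<noteq> {}"
    and rare: "\<And>x. real (card {t\<in>F. \<phi> t x \<in> - A}) \<le> \<epsilon> * real (card F)"
  shows "1 - \<epsilon> \<le> lower_banach_density G \<phi> A"
proof -
  let ?\<F> = "{F. F \<subseteq> carrier G \<and> finite F \<and> F \<noteq> {}}"
  have le1: "real (card {t\<in>E. \<phi> t x \<in> A}) / real (card E) \<le> 1" if "finite E" for E x
    using card_mono[OF that, of "{t\<in>E. \<phi> t x \<in> A}"] by (auto simp: divide_simps)
  have "1 - \<epsilon> \<le> lower_density_along \<phi> F A"
    unfolding lower_density_along_def
  proof (rule cINF_greatest)
    fix x
    have "{t\<in>F. \<phi> t x \<in> A} = F - {t\<in>F. \<phi> t x \<in> - A}" by auto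
    then have "card {t\<in>F. \<phi> t x \<in> A} = card F - card {t\<in>F. \<phi> t x \<in> - A}"
      using assms(2) by (simp add: card_Diff_subset)
    moreover have "card {t\<in>F. \<phi> t x \<in> - A} \<le> card F" using assms(2) by (intro card_mono) auto
    moreover have "real (card F) > 0" using assms by (simp add: card_gt_0_iff)
    moreover from calculation have "(1 - \<epsilon>) * real (card F) \<le> real (card {t\<in>F. \<phi> t x \<in> A})"
      using rare[of x] by (simp add: algebra_simps of_nat_diff)
    ultimately show "1 - \<epsilon> \<le> real (card {t\<in>F. \<phi> t x \<in> A}) / real (card F)"
      by (metis pos_le_divide_eq)
  qed simp
  also have "\<dots> \<le> lower_banach_density G \<phi> A"
    unfolding lower_banach_density_def
  proof (rule cSUP_upper)
    show "F \<in> ?\<F>" using assms by simp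
    show "bdd_above ((\<lambda>F. lower_density_along \<phi> F A) ` ?\<F>)"
    proof (rule bdd_aboveI2)
      fix E assume E: "E \<in> ?\<F>"
      have "lower_density_along \<phi> E A \<le> real (card {t\<in>E. \<phi> t undefined \<in> A}) / real (card E)"
        unfolding lower_density_along_def
        by (rule cINF_lower) (auto intro!: bdd_belowI2[of _ 0])
      then show "lower_density_along \<phi> E A \<le> 1" using le1[of E undefined] E by auto
    qed
  qed
  finally show ?thesis .
qed

lemma fine_castle_reindex:
  assumes "fine_castle K \<delta> \<T>"
  shows "\<exists>(I :: nat set) S V. open_castle G \<phi> I S V \<and>
    (\<forall>i\<in>I. \<forall>s\<in>S i. diameter (\<phi> s ` V i) \<le> \<delta>) \<and>
    (\<forall>i\<in>I. approx_invariant G K \<delta> (S i)) \<and>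
    footprint \<phi> I S V = covered \<T>"
proof -
  have c: "castle G \<phi> \<T> fst snd" using assms unfolding fine_castle_def by simp
  then have fin: "finite \<T>" and tow: "\<And>p. p \<in> \<T> \<Longrightarrow> tower G \<phi> (fst p) (snd p)"
    and disj: "disjoint_family_on (\<lambda>(p, s). \<phi> s ` snd p) (SIGMA p:\<T>. fst p)"
    unfolding castle_def by auto
  obtain e where e: "bij_betw e {0..<card \<T>} \<T>"
    using ex_bij_betw_nat_finite[OF fin] by blast
  let ?I = "{0..<card \<T>}"
  have eT: "e i \<in> \<T>" if "i \<in> ?I" for i using bij_betwE[OF e] that by blast
  have inj: "i = j" if "e i = e j" "i \<in> ?I" "j \<in> ?I" for i j
    using bij_betw_imp_inj_on[OF e] that by (meson inj_onD)
  have towers: "open (snd p)" "approx_invariant G K \<delta> (fst p)" "\<And>s. s \<in> fst p \<Longrightarrow> diameter (\<phi> s ` snd p) \<le> \<delta>"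
    if "p \<in> \<T>" for p
    using assms that unfolding fine_castle_def by auto
  show ?thesis
  proof (intro exI conjI ballI)
    have "disjoint_family_on (\<lambda>(i, s). \<phi> s ` snd (e i)) (SIGMA i:?I. fst (e i))"
      unfolding disjoint_family_on_def
    proof (intro ballI impI)
      fix u v assume uv: "u \<in> (SIGMA i:?I. fst (e i))" "v \<in> (SIGMA i:?I. fst (e i))" "u \<noteq> v"
      obtain i s j t where ij: "u = (i, s)" "v = (j, t)" by (metis surj_pair)
      have "(e i, s) \<in> (SIGMA p:\<T>. fst p)" "(e j, t) \<in> (SIGMA p:\<T>. fst p)" "(e i, s) \<noteq> (e j, t)"
        using uv eT inj unfolding ij by auto
      from disjoint_family_onD[OF disj this]
      show "(case u of (i, s) \<Rightarrow> \<phi> s ` snd (e i)) \<inter> (case v of (i, s) \<Rightarrow> \<phi> s ` snd (e i)) = {}"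
        unfolding ij by simp
    qed
    then show "open_castle G \<phi> ?I (\<lambda>i. fst (e i)) (\<lambda>i. snd (e i))"
      unfolding open_castle_def castle_def using tow eT towers(1) by simp
    show "footprint \<phi> ?I (\<lambda>i. fst (e i)) (\<lambda>i. snd (e i)) = covered \<T>"
    proof -
      have "covered \<T> = footprint \<phi> (e ` ?I) fst snd"
        using bij_betw_imp_surj_on[OF e] by simp
      then show ?thesis unfolding footprint_def by simp
    qed
  qed (use eT towers in auto)
qed

proposition essentially_free_imp_almost_finite_in_measure:
  assumes "amenable_group G" and "essentially_free G \<phi>"
  shows "almost_finite_in_measure G \<phi>"
  unfolding almost_finite_in_measure_def
proof (intro allI impI)
  fix K and \<delta> \<epsilon> :: real
  assume asm: "K \<subseteq> carrier G \<and> finite K \<and> K \<noteq> {} \<and> 0 < \<delta> \<and> 0 < \<epsilon>"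
  then have K: "K \<subseteq> carrier G" "finite K" "K \<noteq> {}" and "0 < \<delta>" "0 < \<epsilon>" by auto
  \<comment> \<open>The proportion lost in trimming; \<open>8\<close> instead of \<open>4\<close> gives the strict inequality needed below.\<close>
  define a where "a = min (1/2) (\<delta> / (8 * (real (card K) + 1)))"
  have pos: "0 < 8 * (real (card K) + 1)" by (simp add: add_nonneg_pos)
  have a: "0 < a" "a \<le> 1/2"
    unfolding a_def using \<open>0 < \<delta>\<close> pos by (simp, intro min.cobounded1)
  have "8 * (real (card K) + 1) * a \<le> 8 * (real (card K) + 1) * (\<delta> / (8 * (real (card K) + 1)))"
    unfolding a_def using pos by (intro mult_left_mono) auto
  then have "8 * (real (card K) + 1) * a \<le> \<delta>" using pos by simp
  then have a3: "4 * (real (card K) + 1) * a < \<delta>" using \<open>0 < \<delta>\<close> by linarith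
  obtain n where n: "(1 - a) ^ n < \<epsilon> / 2"
    using real_arch_pow_inv[of "\<epsilon> / 2" "1 - a"] \<open>0 < \<epsilon>\<close> a by auto
  have "0 < \<epsilon> / 3" using \<open>0 < \<epsilon>\<close> by simp
  obtain \<T> where T: "fine_castle K \<delta> \<T>"
    and T_meas: "\<And>M. M \<in> invariant_measures G \<phi> \<Longrightarrow> 1 - measure M (covered \<T>) \<le> (1 - a) ^ n + \<epsilon> / 3"
    using fine_castle_of_large_measure[OF assms K a a3 empty_subsetI finite.emptyI \<open>0 < \<epsilon> / 3\<close>, of n] by blast
  have clopen: "open (covered \<T>)" "closed (covered \<T>)" using fine_castle_covered_clopen[OF T] by auto
  have small: "measure M (\<Inter>n::nat. - covered \<T>) < \<epsilon>" if M: "M \<in> invariant_measures G \<phi>" for M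
  proof -
    interpret prob_space M using invariant_prob_space(1)[OF M] .
    have "measure M (- covered \<T>) = 1 - measure M (covered \<T>)"
      using prob_compl[of "covered \<T>"] clopen invariant_prob_space(2,3)[OF M]
      by (simp add: Compl_eq_Diff_UNIV)
    then show ?thesis using T_meas[OF M] n \<open>0 < \<epsilon>\<close> by simp
  qed
  have "decseq (\<lambda>n::nat. - covered \<T>)" by (simp add: decseq_def)
  from uniformly_small_frequency[OF assms(1) this open_Compl[OF clopen(2)] closed_Compl[OF clopen(1)] small]
  obtain F where F: "F \<subseteq> carrier G" "finite F" "F \<noteq> {}"
    and rare: "\<And>x. real (card {t\<in>F. \<phi> t x \<in> - covered \<T>}) < \<epsilon> * real (card F)"
    by auto
  have density: "1 - \<epsilon> \<le> lower_banach_density G \<phi> (covered \<T>)"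
    by (rule lower_banach_density_ge[OF F]) (rule less_imp_le[OF rare])
  from fine_castle_reindex[OF T]
  show "\<exists>(I :: nat set) S V. open_castle G \<phi> I S V \<and>
      (\<forall>i\<in>I. \<forall>s\<in>S i. diameter (\<phi> s ` V i) \<le> \<delta>) \<and>
      (\<forall>i\<in>I. approx_invariant G K \<delta> (S i)) \<and>
      lower_banach_density G \<phi> (footprint \<phi> I S V) \<ge> 1 - \<epsilon>"
    by (elim ex_forward conj_forward) (use density in simp_all)
qed

end

theorem theorem1:
  fixes G :: "('g, 'b) monoid_scheme"
    and \<phi> :: "'g \<Rightarrow> 'x \<Rightarrow> 'x::metric_space"
  assumes "amenable_group G"
    and "countable (carrier G)"
    and "compact (UNIV :: 'x set)"
    and "(euclidean :: 'x topology) dim_le 0"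
    and "acts_by_homeomorphisms G \<phi>"
    and "essentially_free G \<phi>"
  shows "almost_finite_in_measure G \<phi>"
proof -
  interpret action: group_action G UNIV \<phi>
    using assms(5) unfolding acts_by_homeomorphisms_def by simp
  interpret group G using assms(1) unfolding amenable_group_def by simp
  interpret compact_zero_dim_action G \<phi>
  proof unfold_locales
    show "\<phi> (g \<otimes>\<^bsub>G\<^esub> h) x = \<phi> g (\<phi> h x)" if "g \<in> carrier G" "h \<in> carrier G" for g h x
      using action.composition_rule that by simp
    show "\<phi> \<one>\<^bsub>G\<^esub> x = x" for x
      using action.id_eq_one by (metis UNIV_I restrict_apply')
    show "continuous_on UNIV (\<phi> g)" if "g \<in> carrier G" for g
      using assms(5) that homeomorphic_imp_continuous_map
      unfolding acts_by_homeomorphisms_def by fastforce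
    show "compact (UNIV :: 'x set)" by fact
    show "\<exists>B. open B \<and> closed B \<and> x \<in> B \<and> B \<subseteq> W" if "open W" "x \<in> W" for W :: "'x set" and x
    proof -
      have "\<exists>U V. open U \<and> (closed V \<and> open V) \<and> x \<in> U \<and> U \<subseteq> V \<and> V \<subseteq> W"
        using assms(4) that
        by (simp add: dimension_le_0_neighbourhood_base_of_clopen neighbourhood_base_of)
      then show ?thesis by blast
    qed
  qed
  show ?thesis
    using essentially_free_imp_almost_finite_in_measure assms(1,6) .
qed

end
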